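(* For every integer $k \ge 0$, $k\text{-}\mathrm{NEXPTIME} = k\text{-}\mathrm{NEXPWOSPACE}$.
   Context: Let $\exp_0(x)=x$ and $\exp_{j+1}(x)=2^{\exp_j(x)}$. $k\text{-}\mathrm{NEXPTIME}$ is the class of languages accepted by ordinary nondeterministic Turing machines in time $\exp_k(n^t)$ for some constant $t$. A write-once Turing machine is a Turing machine with a single tape, infinite in one direction, a single read/write head, and tape alphabet $\{0,1\}$ (0 = blank, 1 = marked), which may never write a blank onto a marked cell (re-marking a marked cell is allowed). $k\text{-}\mathrm{NEXPWOSPACE}$ is the class of languages accepted by nondeterministic write-once Turing machines using at most $\exp_k(n^t)$ tape cells on inputs of length $n$, for some constant $t$. *)

theory Defs
  imports Main
begin

primrec iter_exp :: "nat \<Rightarrow> nat \<Rightarrow> nat" where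
  "iter_exp 0 x = x"
| "iter_exp (Suc j) x = 2 ^ iter_exp j x"

datatype move = MoveLeft | Stay | MoveRight

(* Tape symbols are the numbers below num_syms; symbol 0 is the blank. *)
record ntm =
  states :: "nat set"
  num_syms :: nat
  start :: nat
  accepting :: "nat set"
  trans :: "(nat \<times> nat \<times> nat \<times> nat \<times> move) set"

definition wf_ntm :: "ntm \<Rightarrow> bool" where
  "wf_ntm M \<longleftrightarrow>
     finite (states M) \<and> start M \<in> states M \<and> accepting M \<subseteq> states M \<and>
     trans M \<subseteq> states M \<times> {..<num_syms M} \<times> states M \<times> {..<num_syms M} \<times> UNIV"

(* Control state, head position, tape contents.  The tape is infinite to the right only. *)
type_synonym config = "nat \<times> nat \<times> (nat \<Rightarrow> nat)"

definition state_of :: "config \<Rightarrow> nat" where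
  "state_of c = fst c"

definition head_of :: "config \<Rightarrow> nat" where
  "head_of c = fst (snd c)"

(* A left move on cell 0 leaves the head on cell 0 (truncated subtraction). *)
fun move_head :: "move \<Rightarrow> nat \<Rightarrow> nat" where
  "move_head MoveLeft h = h - 1"
| "move_head Stay h = h"
| "move_head MoveRight h = h + 1"

inductive step :: "ntm \<Rightarrow> config \<Rightarrow> config \<Rightarrow> bool" for M where
  "(q, tp h, q', b, d) \<in> trans M \<Longrightarrow> step M (q, h, tp) (q', move_head d h, tp(h := b))"

definition init_config :: "ntm \<Rightarrow> nat list \<Rightarrow> config" where
  "init_config M xs = (start M, 0, \<lambda>i. if i < length xs then xs ! i else 0)"

definition accepting_run :: "ntm \<Rightarrow> nat list \<Rightarrow> config list \<Rightarrow> bool" where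
  "accepting_run M xs cs \<longleftrightarrow>
     cs \<noteq> [] \<and> hd cs = init_config M xs \<and> successively (step M) cs \<and>
     state_of (last cs) \<in> accepting M"

definition run_time :: "config list \<Rightarrow> nat" where
  "run_time cs = length cs - 1"

definition run_space :: "config list \<Rightarrow> nat" where
  "run_space cs = card (head_of ` set cs)"

(* Ordinary machines work over any finite tape alphabet containing, besides the blank,
   the two input symbols 1 and 2, which stand for the input bits 0 and 1. *)
definition ordinary_ntm :: "ntm \<Rightarrow> bool" where
  "ordinary_ntm M \<longleftrightarrow> wf_ntm M \<and> 3 \<le> num_syms M"

definition ordinary_input :: "bool list \<Rightarrow> nat list" where
  "ordinary_input w = map (\<lambda>b. if b then 2 else 1) w"

definition write_once_ntm :: "ntm \<Rightarrow> bool" where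
  "write_once_ntm M \<longleftrightarrow>
     wf_ntm M \<and> num_syms M = 2 \<and> (\<forall>q q' d. (q, 1, q', 0, d) \<notin> trans M)"

(* On a tape whose only symbols are blank and marked, a raw bit string could not be told
   apart from the same string with zeros appended.  Hence each input bit occupies two cells,
   exactly one of which is marked; two blank cells signal the end of the input. *)
definition write_once_input :: "bool list \<Rightarrow> nat list" where
  "write_once_input w = concat (map (\<lambda>b. if b then [1, 0] else [0, 1]) w)"

(* As usual for nondeterministic acceptance, a resource bound asks that every accepted word
   have some accepting run within the bound.  The bound is imposed for n \<ge> 2 only: for n < 2
   the value n ^ t does not grow with t, so that literally even a constant number of steps
   would be excluded there; this concerns just three words.  For n \<ge> 2 any finite slack
   is absorbed by t. *)
definition k_NEXPTIME :: "nat \<Rightarrow> bool list set set" where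
  "k_NEXPTIME k =
     {L. \<exists>M t. ordinary_ntm M \<and>
           L = {w. \<exists>cs. accepting_run M (ordinary_input w) cs} \<and>
           (\<forall>w\<in>L. 2 \<le> length w \<longrightarrow>
              (\<exists>cs. accepting_run M (ordinary_input w) cs \<and>
                    run_time cs \<le> iter_exp k (length w ^ t)))}"

definition k_NEXPWOSPACE :: "nat \<Rightarrow> bool list set set" where
  "k_NEXPWOSPACE k =
     {L. \<exists>M t. write_once_ntm M \<and>
           L = {w. \<exists>cs. accepting_run M (write_once_input w) cs} \<and>
           (\<forall>w\<in>L. 2 \<le> length w \<longrightarrow>
              (\<exists>cs. accepting_run M (write_once_input w) cs \<and>
                    run_space cs \<le> iter_exp k (length w ^ t)))}"

end

theory Submission
  imports Defs "HOL-Library.Nat_Bijection"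
begin

text \<open>
  A write-once run within space \<open>s\<close> can change the tape at most \<open>s\<close> times, and between two
  changes only the state and the head position vary; so it has polynomially many configurations
  and can be shortcut to polynomial length.  An ordinary machine simulates it step by step, with two
  write-once cells per cell.

  Conversely, to simulate an ordinary machine with \<open>g\<close> symbols on a tape that can only be marked,
  every simulated cell becomes a block of slots, whose number is guessed in advance.  The number of
  used slots modulo \<open>g\<close> is the current content of the cell, so that writing means using up at most
  \<open>2 g\<close> further slots.  A run of length \<open>T\<close> on an input of length \<open>n\<close> needs no more than
  \<open>n + T + 1\<close> blocks of about \<open>2 g T\<close> slots each, and no copying of configurations.  Polynomial
  factors are absorbed by the exponent \<open>t\<close>.
\<close>

text \<open>The obstacle is that a write-once tape offers no erasable mark: neither a counter nor
  the position of the simulated head can be kept on it. Counting modulo \<open>g\<close> fits into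
  the finite control, and between simulated steps the head simply stands on the separator of the
  current block, so nothing has to record it. A guess of too few slots or blocks makes the machine
  get stuck and never makes it accept wrongly; hence soundness holds for all guesses, and sizes
  matter only for completeness. The simulation needs four symbols, obtained as pairs of bits.
  Marking only moves upwards in the bitwise order, where 0 lies below 1 and 2, and both of these
  below 3; the two codes of input bits are incomparable, yet both can be raised to 3. The machine is
  assembled from programs whose semantics has the set \<open>H\<close> of permitted head positions
  as a parameter. Most pieces are described by an equivalence in \<open>H\<close>, which is used
  twice: with \<open>UNIV\<close> for soundness and with \<open>{..<S}\<close> for the space bound.
  The number of steps of the write-once machine is never bounded.\<close>

section \<open>Growth of iterated exponentials\<close>

lemma iter_exp_ge_arg: "x \<le> iter_exp k x"
proof (induction k)
  case (Suc k)
  have "iter_exp k x < 2 ^ iter_exp k x" by (rule less_exp)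
  with Suc show ?case by (simp only: iter_exp.simps)
qed simp

lemma iter_exp_mono: "x \<le> y \<Longrightarrow> iter_exp k x \<le> iter_exp k y"
  by (induction k) (auto intro: power_increasing)

lemma mult_le_power:
  fixes a j :: nat
  assumes "1 \<le> j" "2 \<le> a"
  shows "a * j \<le> a ^ j"
  using assms(1)
proof (induction j rule: dec_induct)
  case (step j)
  have "a \<le> a ^ j" using step.hyps assms(2) by (intro self_le_power) auto
  with step.IH have "a * Suc j \<le> 2 * a ^ j" by simp
  also have "\<dots> \<le> a ^ Suc j" using assms(2) by simp
  finally show ?case .
qed simp

text \<open>A power of \<open>2 ^ a\<close> multiplies the exponent by \<open>j\<close>, and
  \<open>a * j \<le> a ^ j\<close> turns this into a power one level further down, until the power
  reaches the argument.\<close>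

lemma iter_exp_power_le: "2 \<le> x \<Longrightarrow> 1 \<le> j \<Longrightarrow> iter_exp k x ^ j \<le> iter_exp k (x ^ j)"
proof (induction k)
  case (Suc k)
  have "iter_exp k x * j \<le> iter_exp k x ^ j"
    using Suc.prems iter_exp_ge_arg[of x k] by (intro mult_le_power) auto
  also have "\<dots> \<le> iter_exp k (x ^ j)" using Suc by simp
  finally show ?case by (simp flip: power_mult)
qed simp

text \<open>Everything is compared with powers of one quantity \<open>?s \<ge> 2\<close>: the sum is
  at most \<open>?s ^ 2\<close> and the constant at most \<open>?s ^ C\<close>. Both inclusions use
  this, with \<open>j = 4\<close> and \<open>j = 2\<close>.\<close>

lemma iter_exp_absorbs_polynomial:
  fixes C :: nat and t k j :: nat
  shows "\<exists>t'. \<forall>n\<ge>2. C * (iter_exp k (n ^ t) + n) ^ j \<le> iter_exp k (n ^ t')"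
proof (intro exI allI impI)
  fix n :: nat
  assume n: "2 \<le> n"
  \<comment> \<open>\<open>Suc t\<close> instead of \<open>t\<close> ensures
    \<open>n \<le> ?s\<close> even for \<open>t = 0\<close>.\<close>
  let ?s = "iter_exp k (n ^ Suc t)"
  have ge2: "2 \<le> n ^ Suc t" using n self_le_power[of n "Suc t"] by linarith
  then have s2: "2 \<le> ?s" using iter_exp_ge_arg le_trans by blast
  have "n \<le> ?s"
    using n iter_exp_ge_arg[of "n ^ Suc t" k] self_le_power[of n "Suc t"] by linarith
  moreover have "iter_exp k (n ^ t) \<le> ?s"
    using n by (intro iter_exp_mono power_increasing) auto
  ultimately have "iter_exp k (n ^ t) + n \<le> ?s * 2" by simp
  also have "\<dots> \<le> ?s ^ 2" using s2 by (simp add: power2_eq_square)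
  finally have "(iter_exp k (n ^ t) + n) ^ j \<le> (?s ^ 2) ^ j" by (rule power_mono) simp
  moreover have "C \<le> ?s ^ C" using s2 power_mono[OF s2, of C] less_exp[of C] by linarith
  ultimately have "C * (iter_exp k (n ^ t) + n) ^ j \<le> ?s ^ C * (?s ^ 2) ^ j" by (rule mult_le_mono[rotated])
  also have "\<dots> = ?s ^ (C + 2 * j)" by (simp add: power_add power_mult)
  \<comment> \<open>The exponent must be positive for \<open>iter_exp_power_le\<close>.\<close>
  also have "\<dots> \<le> ?s ^ Suc (C + 2 * j)" using s2 by (intro power_increasing) auto
  also have "\<dots> \<le> iter_exp k ((n ^ Suc t) ^ Suc (C + 2 * j))"
    using ge2 by (intro iter_exp_power_le) auto
  finally show "C * (iter_exp k (n ^ t) + n) ^ j \<le> iter_exp k (n ^ (Suc t * Suc (C + 2 * j)))"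
    by (simp only: power_mult)
qed

section \<open>Runs as powers of the step relation\<close>

lemma relpowp_of_successively:
  "successively P cs \<Longrightarrow> cs \<noteq> [] \<Longrightarrow> (P ^^ (length cs - 1)) (hd cs) (last cs)"
  unfolding relpowp_fun_conv
  by (rule exI[of _ "nth cs"]) (auto simp: hd_conv_nth last_conv_nth successively_conv_nth)

lemma successively_of_relpowp:
  assumes "(P ^^ n) x y"
  obtains cs where "cs \<noteq> []" "hd cs = x" "last cs = y" "successively P cs" "length cs = Suc n"
proof -
  obtain f where f: "f 0 = x" "f n = y" "\<forall>i<n. P (f i) (f (Suc i))"
    using assms unfolding relpowp_fun_conv by auto
  show thesis
    by (rule that[of "map f [0..<Suc n]"])
      (use f in \<open>auto simp: hd_map last_map successively_conv_nth simp del: upt_Suc\<close>)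
qed

text \<open>Replaces lists of configurations by powers of \<open>step\<close>, through which
  simulations are proved by induction on the number of steps.\<close>

definition accepts_in :: "ntm \<Rightarrow> nat list \<Rightarrow> nat \<Rightarrow> bool" where
  "accepts_in M xs n \<longleftrightarrow> (\<exists>c. (step M ^^ n) (init_config M xs) c \<and> state_of c \<in> accepting M)"

lemma accepts_in_iff:
  "accepts_in M xs n \<longleftrightarrow> (\<exists>cs. accepting_run M xs cs \<and> run_time cs = n)"
proof
  assume "accepts_in M xs n"
  then obtain c where c: "(step M ^^ n) (init_config M xs) c" "state_of c \<in> accepting M"
    unfolding accepts_in_def by blast
  from c(1) obtain cs where "cs \<noteq> []" "hd cs = init_config M xs" "last cs = c"
      "successively (step M) cs" "length cs = Suc n"
    by (rule successively_of_relpowp)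
  with c(2) show "\<exists>cs. accepting_run M xs cs \<and> run_time cs = n"
    unfolding accepting_run_def run_time_def by (intro exI[of _ cs]) auto
next
  assume "\<exists>cs. accepting_run M xs cs \<and> run_time cs = n"
  then obtain cs where "accepting_run M xs cs" "run_time cs = n" by blast
  then show "accepts_in M xs n"
    unfolding accepts_in_def accepting_run_def run_time_def
    using relpowp_of_successively by metis
qed

lemma accepting_run_iff: "(\<exists>cs. accepting_run M xs cs) \<longleftrightarrow> (\<exists>n. accepts_in M xs n)"
  by (auto simp: accepts_in_iff)

lemma step_iff:
  "step M c c' \<longleftrightarrow> (\<exists>q h tp q' b d. c = (q, h, tp) \<and> (q, tp h, q', b, d) \<in> trans M \<and>
     c' = (q', move_head d h, tp(h := b)))"
  unfolding step.simps by metis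

lemma step_triple_iff:
  "step M (q, h, tp) c' \<longleftrightarrow>
    (\<exists>q' b d. (q, tp h, q', b, d) \<in> trans M \<and> c' = (q', move_head d h, tp(h := b)))"
  unfolding step_iff prod.inject by metis

lemma head_of_step_le:
  assumes "step M c c'"
  shows "head_of c' \<le> Suc (head_of c)"
proof -
  have "move_head d h \<le> Suc h" for d h by (cases d) auto
  with assms show ?thesis by (auto simp: step_iff head_of_def)
qed

lemma length_ordinary_input [simp]: "length (ordinary_input w) = length w"
  by (simp add: ordinary_input_def)

definition tape :: "nat list \<Rightarrow> nat \<Rightarrow> nat" where
  "tape xs i = (if i < length xs then xs ! i else 0)"

lemma init_config_tape: "init_config M xs = (start M, 0, tape xs)"
  by (auto simp: init_config_def tape_def)

text \<open>The two cells of an input bit are the binary digits of the ordinary symbol, 01 for 1 and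
  10 for 2, and a blank pair is 0. Both simulations pair up cells in this way, so neither has to
  translate the input.\<close>

lemma tape_write_once_input:
  "tape (write_once_input w) (2 * i) = tape (ordinary_input w) i div 2 \<and>
   tape (write_once_input w) (Suc (2 * i)) = tape (ordinary_input w) i mod 2"
proof (induction w arbitrary: i)
  case Nil
  then show ?case by (simp add: tape_def write_once_input_def ordinary_input_def)
next
  case (Cons b w)
  have "tape (write_once_input (b # w)) i = (if i = 0 then (if b then 1 else 0) else if i = 1 then (if b then 0 else 1)
      else tape (write_once_input w) (i - 2))" 
    "tape (ordinary_input (b # w)) i = (if i = 0 then (if b then 2 else 1) else tape (ordinary_input w) (i - 1))" for i
    by (auto simp: tape_def nth_Cons' ordinary_input_def write_once_input_def numeral_2_eq_2)
  with Cons[of "i - 1"] show ?case by (cases i) auto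
qed

lemma tape_ordinary_input_less: "tape (ordinary_input w) i < 3"
  by (auto simp: tape_def ordinary_input_def)

lemma tape_write_once_input_less: "tape (write_once_input w) i < 2"
proof (cases "even i")
  case True
  then show ?thesis
    using tape_write_once_input[of w "i div 2"] tape_ordinary_input_less[of w "i div 2"] by auto
next
  case False
  then show ?thesis
    using tape_write_once_input[of w "i div 2"] by auto
qed

section \<open>Simulating a write-once machine in polynomial time\<close>

text \<open>The head starts at 0 and advances by at most one cell per step, so it has visited every
  cell up to its present one. Thus the number of visited cells also bounds the positions.\<close>

lemma head_of_less_run_space:
  assumes "successively (step M) cs" "cs \<noteq> []" "head_of (hd cs) = 0" "i < length cs"
  shows "head_of (cs ! i) < run_space cs"
proof -
  have "{..head_of (cs ! i)} \<subseteq> head_of ` set cs"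
    using assms(4)
  proof (induction i)
    case 0
    then show ?case using assms by (auto simp: hd_conv_nth intro!: image_eqI[of _ _ "cs ! 0"])
  next
    case (Suc i)
    then have "step M (cs ! i) (cs ! Suc i)"
      using assms(1) by (simp add: successively_conv_nth)
    then have "{..head_of (cs ! Suc i)} \<subseteq> insert (head_of (cs ! Suc i)) {..head_of (cs ! i)}"
      by (auto dest: head_of_step_le)
    with Suc show ?case by auto
  qed
  from card_mono[OF _ this] show ?thesis by (simp add: run_space_def)
qed

definition marked :: "config \<Rightarrow> nat set" where
  "marked c = {i. snd (snd c) i = 1}"

definition binary :: "config \<Rightarrow> bool" where
  "binary c \<longleftrightarrow> (\<forall>i. snd (snd c) i < 2)"

lemma binary_step:
  assumes "write_once_ntm M" "step M c c'" "binary c"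
  shows "binary c'" "marked c \<subseteq> marked c'" "marked c' \<subseteq> insert (head_of c) (marked c)"
    "state_of c' \<in> states M"
proof -
  obtain q h tp q' b d where c: "c = (q, h, tp)" "(q, tp h, q', b, d) \<in> trans M"
    "c' = (q', move_head d h, tp(h := b))"
    using assms(2) by (auto simp: step_iff)
  moreover have "b < 2" "q' \<in> states M" using assms(1) c(2) by (auto simp: write_once_ntm_def wf_ntm_def)
  moreover have "b = 1" if "tp h = 1" 
  proof (rule ccontr)
    assume "b \<noteq> 1"
    then have "b = 0" using \<open>b < 2\<close> by simp
    then show False using c(2) that assms(1) by (auto simp: write_once_ntm_def)
  qed
  ultimately show "binary c'" "marked c \<subseteq> marked c'" "marked c' \<subseteq> insert (head_of c) (marked c)"
    "state_of c' \<in> states M"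
    using assms(3) by (auto simp: binary_def marked_def head_of_def state_of_def)
qed

lemma relpowp_binary:
  assumes "write_once_ntm M" "(step M ^^ n) c c'" "binary c"
  shows "binary c'"
  using assms(2,3) by (induction n arbitrary: c') (auto dest: binary_step(1)[OF assms(1)])

lemma config_eqI:
  assumes "binary c" "binary c'" "state_of c = state_of c'" "head_of c = head_of c'"
    "marked c = marked c'"
  shows "c = c'"
proof -
  have "snd (snd c) i = snd (snd c') i" for i
  proof -
    have "snd (snd c) i < 2" "snd (snd c') i < 2" "snd (snd c) i = 1 \<longleftrightarrow> snd (snd c') i = 1"
      using assms by (auto simp: binary_def marked_def set_eq_iff)
    then show ?thesis by linarith
  qed
  then show ?thesis using assms by (auto simp: state_of_def head_of_def prod_eq_iff)
qed

text \<open>Along a write-once run the tapes form a chain, so a configuration is determined by its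
  state, its head position and its number of marked cells.\<close>

lemma card_configs_run:
  assumes M: "write_once_ntm M" and run: "successively (step M) cs" "cs \<noteq> []"
    and hd: "head_of (hd cs) = 0" "binary (hd cs)" "state_of (hd cs) \<in> states M"
    and sp: "run_space cs \<le> s"
  shows "card (set cs) \<le> card (states M) * (s * Suc s)"
proof -
  \<comment> \<open>As an implication the relation holds for every step and is still transitive, so
    it extends from neighbours to all pairs of configurations of the run.\<close>
  let ?R = "\<lambda>c c'. binary c \<longrightarrow> binary c' \<and> marked c \<subseteq> marked c'"
  have "successively ?R cs"
    using run(1) by (rule successively_mono) (use binary_step[OF M] in blast)
  then have sorted: "sorted_wrt ?R cs"
    by (subst (asm) successively_conv_sorted_wrt) (auto simp: transp_def)
  have head: "head_of c < s" if "c \<in> set cs" for c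
    using head_of_less_run_space[OF run hd(1)] sp that by (fastforce simp: in_set_conv_nth)
  have inv: "binary (cs ! i) \<and> state_of (cs ! i) \<in> states M \<and> marked (cs ! i) - {..<s} = marked (hd cs) - {..<s}"
    if "i < length cs" for i
    using that
  proof (induction i)
    case 0
    then show ?case using hd run by (auto simp: hd_conv_nth)
  next
    case (Suc i)
    then have st: "step M (cs ! i) (cs ! Suc i)"
      using run by (simp add: successively_conv_nth)
    moreover have "head_of (cs ! i) < s" using Suc head by auto
    ultimately show ?case
      using binary_step[OF M st] Suc by auto
  qed
  have bin: "binary c" "state_of c \<in> states M" "marked c - {..<s} = marked (hd cs) - {..<s}"
    if "c \<in> set cs" for c
    using inv that by (auto simp: in_set_conv_nth)
  \<comment> \<open>Beyond \<open>s\<close> all tapes of the run agree, since the head never gets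
    there; below \<open>s\<close> the marked sets are finite and comparable by inclusion, so their
    cardinality determines them.\<close>
  define \<mu> where "\<mu> c = (state_of c, head_of c, card (marked c \<inter> {..<s}))" for c
  have "c = c'" if "c \<in> set cs" "c' \<in> set cs" "\<mu> c = \<mu> c'" for c c'
  proof (rule config_eqI)
    have "marked c \<subseteq> marked c' \<or> marked c' \<subseteq> marked c"
    proof -
      obtain i j where ij: "i < length cs" "j < length cs" "c = cs ! i" "c' = cs ! j"
        using \<open>c \<in> set cs\<close> \<open>c' \<in> set cs\<close> by (auto simp: in_set_conv_nth)
      then show ?thesis
        using sorted inv[of i] inv[of j] unfolding sorted_wrt_iff_nth_less
        by (metis linorder_neqE_nat order_refl)
    qed
    then have "marked c \<inter> {..<s} \<subseteq> marked c' \<inter> {..<s} \<or> marked c' \<inter> {..<s} \<subseteq> marked c \<inter> {..<s}"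
      by auto
    then have "marked c \<inter> {..<s} = marked c' \<inter> {..<s}"
      using that(3) by (metis \<mu>_def card_subset_eq finite_Int finite_lessThan prod.inject)
    moreover have "marked c - {..<s} = marked c' - {..<s}" using bin that by metis
    ultimately show "marked c = marked c'" by blast
  qed (use that bin in \<open>auto simp: \<mu>_def\<close>)
  then have "inj_on \<mu> (set cs)" by (auto intro: inj_onI)
  moreover have "\<mu> ` set cs \<subseteq> states M \<times> ({..<s} \<times> {..<Suc s})"
  proof -
    have "card (marked c \<inter> {..<s}) \<le> s" for c
      using card_mono[of "{..<s}" "marked c \<inter> {..<s}"] by simp
    then show ?thesis using bin head by (auto simp: \<mu>_def less_Suc_eq_le)
  qed
  moreover have "finite (states M)" using M by (simp add: write_once_ntm_def wf_ntm_def)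
  ultimately have "card (set cs) \<le> card (states M \<times> ({..<s} \<times> {..<Suc s}))"
    by (metis card_inj_on_le finite_SigmaI finite_lessThan)
  then show ?thesis by (simp only: card_cartesian_product card_lessThan)
qed

text \<open>Restricted to the configurations of the given run, \<open>step\<close> is a finite
  relation \<open>R\<close>, and whatever is reachable in it is reachable in at most
  \<open>card R\<close> steps. The square comes from counting pairs of configurations.\<close>

lemma short_accepting_run:
  assumes M: "write_once_ntm M" and run: "accepting_run M (write_once_input w) cs"
    and sp: "run_space cs \<le> s"
  obtains n where "accepts_in M (write_once_input w) n" "n \<le> (card (states M) * (s * Suc s))\<^sup>2"
proof -
  have cs: "cs \<noteq> []" "hd cs = init_config M (write_once_input w)" "successively (step M) cs"
    "state_of (last cs) \<in> accepting M"
    using run by (auto simp: accepting_run_def)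
  define R where "R = {(c, c'). c \<in> set cs \<and> c' \<in> set cs \<and> step M c c'}"
  have sub: "R \<subseteq> set cs \<times> set cs" by (auto simp: R_def)
  then have fin: "finite R" by (rule finite_subset) auto
  have "successively (\<lambda>c c'. (c, c') \<in> R) cs"
    using cs(3) by (rule successively_mono) (auto simp: R_def)
  from relpowp_of_successively[OF this cs(1)]
  have "(hd cs, last cs) \<in> R ^^ (length cs - 1)" by (simp add: relpowp_relpow_eq)
  then obtain n where n: "n \<le> card R" "(hd cs, last cs) \<in> R ^^ n"
    using relpow_finite_bounded[OF fin, of "length cs - 1"] by blast
  have "((\<lambda>c c'. (c, c') \<in> R) ^^ n) (hd cs) (last cs)"
    using n(2) by (simp add: relpowp_relpow_eq)
  then have "(step M ^^ n) (hd cs) (last cs)"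
    by (auto simp: relpowp_fun_conv R_def)
  then have "accepts_in M (write_once_input w) n"
    using cs unfolding accepts_in_def by metis
  moreover have "card (set cs) \<le> card (states M) * (s * Suc s)"
    using M cs(3,1)
  proof (rule card_configs_run)
    show "state_of (hd cs) \<in> states M"
      using M by (simp add: cs init_config_def state_of_def write_once_ntm_def wf_ntm_def)
    show "binary (hd cs)"
      by (simp add: cs init_config_tape binary_def tape_write_once_input_less)
  qed (simp_all add: cs init_config_def head_of_def sp)
  then have "card R \<le> (card (states M) * (s * Suc s))\<^sup>2"
    using card_mono[OF _ sub] by (simp add: card_cartesian_product power2_eq_square)
      (meson le_trans mult_le_mono)
  ultimately show thesis using that n(1) by (meson le_trans)
qed

section \<open>Packing two binary cells into one cell\<close>

text \<open>\<open>Suc\<close> keeps the number 0 free for the new start state.\<close>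

definition pstate :: "nat \<Rightarrow> nat \<Rightarrow> nat" where
  "pstate q p = Suc (prod_encode (q, p))"

lemma pstate_eq_iff [simp]: "pstate q p = pstate q' p' \<longleftrightarrow> q = q' \<and> p = p'"
  by (simp add: pstate_def)

lemma pstate_neq_0 [simp]: "pstate q p \<noteq> 0" "0 \<noteq> pstate q p"
  by (simp_all add: pstate_def)

text \<open>Here \<open>p\<close> is the parity of the simulated head position and \<open>e\<close>
  tells whether the pair is the leftmost one. From its even cell a left move must stay in place,
  which is why the left end has to be recognizable.\<close>

fun pmove :: "move \<Rightarrow> nat \<Rightarrow> nat \<Rightarrow> nat \<times> move" where
  "pmove Stay p e = (p, Stay)"
| "pmove MoveRight p e = (if p = 0 then (1, Stay) else (0, MoveRight))"
| "pmove MoveLeft p e = (if p = 1 \<or> e = 1 then (0, Stay) else (1, MoveLeft))"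

text \<open>The cell i of this machine holds the cells 2i and 2i+1 of \<open>M\<close>; on the symbols 1 and 2
  this agrees with the two encodings of the input.  The state remembers the parity of the head
  position.  The summand 4, added to cell 0 by the first step, makes the left end of the tape
  recognizable.\<close>

definition pair_ntm :: "ntm \<Rightarrow> ntm" where
  "pair_ntm M = \<lparr>states = insert 0 ((\<lambda>(q, p). pstate q p) ` (states M \<times> {..<2})),
     num_syms = 8, start = 0,
     accepting = (\<lambda>(q, p). pstate q p) ` (accepting M \<times> {..<2}),
     trans = {(0, x, pstate (start M) 0, x + 4, Stay) | x. x < 4} \<union>
       {(pstate q p, 4 * e + 2 * u 0 + u 1, pstate q' (fst (pmove d p e)),
         4 * e + 2 * (u(p := b)) 0 + (u(p := b)) 1, snd (pmove d p e)) | q p e u q' b d.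
         p < 2 \<and> e < 2 \<and> u (0::nat) < 2 \<and> u 1 < 2 \<and> (q, u p, q', b, d) \<in> trans M}\<rparr>"

fun pair_config :: "config \<Rightarrow> config" where
  "pair_config (q, h, tp) =
     (pstate q (h mod 2), h div 2,
      \<lambda>i. 4 * (if i = 0 then 1 else 0) + 2 * tp (2 * i) + tp (Suc (2 * i)))"

lemma trans_pair_ntm_cases:
  assumes "x \<in> trans (pair_ntm M)"
  obtains y where "y < 4" "x = (0, y, pstate (start M) 0, y + 4, Stay)"
  | q p e u q' b d where "p < 2" "e < 2" "u (0::nat) < 2" "u 1 < 2" "(q, u p, q', b, d) \<in> trans M"
        "x = (pstate q p, 4 * e + 2 * u 0 + u 1, pstate q' (fst (pmove d p e)),
          4 * e + 2 * (u(p := b)) 0 + (u(p := b)) 1, snd (pmove d p e))"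
  using assms unfolding pair_ntm_def ntm.simps by blast

lemma ordinary_pair_ntm:
  assumes "write_once_ntm M"
  shows "ordinary_ntm (pair_ntm M)"
proof -
  have wf: "finite (states M)" "start M \<in> states M" "accepting M \<subseteq> states M"
    "trans M \<subseteq> states M \<times> {..<2} \<times> states M \<times> {..<2} \<times> UNIV"
    using assms by (auto simp: write_once_ntm_def wf_ntm_def)
  have pm: "fst (pmove d p e) < 2" if "p < 2" for d p e
    using that by (cases d) auto
  have lt8: "4 * e + 2 * x + y < 8" if "e < 2" "x < 2" "y < 2" for e x y :: nat
    using that by linarith
  have tr: "b < 2 \<and> q \<in> states M \<and> q' \<in> states M" if "(q, a, q', b, d) \<in> trans M" for q a q' b d
    using wf that by auto
  have "trans (pair_ntm M) \<subseteq> states (pair_ntm M) \<times> {..<8} \<times> states (pair_ntm M) \<times> {..<8} \<times> UNIV"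
  proof
    fix x assume "x \<in> trans (pair_ntm M)"
    then show "x \<in> states (pair_ntm M) \<times> {..<8} \<times> states (pair_ntm M) \<times> {..<8} \<times> UNIV"
    proof (cases rule: trans_pair_ntm_cases)
      case 1
      then show ?thesis using wf(2) by (simp add: pair_ntm_def image_iff)
    next
      case (2 q p e u q' b d)
      note tr = tr[OF 2(5)]
      then have "(u(p := b)) 0 < 2" "(u(p := b)) 1 < 2" using 2 by auto
      from lt8[OF 2(2) this] lt8[OF 2(2-4)] show ?thesis
        unfolding 2(6) using tr pm[OF 2(1)] 2(1)
        by (simp only: mem_Sigma_iff lessThan_iff) (simp add: pair_ntm_def image_iff)
    qed
  qed
  moreover have "finite (states (pair_ntm M))" "start (pair_ntm M) \<in> states (pair_ntm M)"
    "accepting (pair_ntm M) \<subseteq> states (pair_ntm M)" "num_syms (pair_ntm M) = 8"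
    using wf by (auto simp: pair_ntm_def)
  ultimately show ?thesis by (simp add: ordinary_ntm_def wf_ntm_def)
qed

lemma pair_config_upd:
  fixes k r e b :: nat
  assumes r: "r < 2" and e: "e = (if k = 0 then 1 else 0)" and u: "u 0 = tp (2 * k)" "u 1 = tp (Suc (2 * k))"
  shows "pair_config (q', move_head d (2 * k + r), tp(2 * k + r := b)) =
    (pstate q' (fst (pmove d r e)), move_head (snd (pmove d r e)) k,
     (snd (snd (pair_config (q, 2 * k + r, tp))))(k := 4 * e + 2 * (u(r := b)) 0 + (u(r := b)) 1))"
proof -
  have "r = 0 \<or> r = 1" using r by auto
  moreover have "move_head d (2 * k + r) mod 2 = fst (pmove d r e)"
    "move_head d (2 * k + r) div 2 = move_head (snd (pmove d r e)) k"
    using calculation e by (cases d; cases k; auto)+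
  moreover have "2 * i \<noteq> Suc (2 * j)" for i j :: nat by presburger
  ultimately show ?thesis
    using e u by (auto simp: fun_eq_iff)
qed

text \<open>This bisimulation works because a packed symbol has only one decomposition into binary
  digits, so the two cells named by a transition are those on the tape.\<close>

lemma step_pair_ntm_iff:
  assumes "binary c"
  shows "step (pair_ntm M) (pair_config c) d \<longleftrightarrow> (\<exists>c'. d = pair_config c' \<and> step M c c')"
proof -
  obtain q h tp where "c = (q, h, tp)" by (metis prod_cases3)
  moreover define k r where "k = h div 2" and "r = h mod 2"
  ultimately have c: "c = (q, 2 * k + r, tp)" and r: "r < 2" by simp_all
  then have r01: "r = 0 \<or> r = 1" by auto
  define e :: nat where "e = (if k = 0 then 1 else 0)"
  define u where "u j = tp (2 * k + j)" for j
  note upd = pair_config_upd[where u = u and tp = tp and q = q, OF r e_def]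
  have bin: "tp i < 2" for i using assms by (simp add: c binary_def)
  define T where "T = snd (snd (pair_config c))"
  have pc: "pair_config c = (pstate q r, k, T)"
    using r by (simp add: c T_def)
  have sym: "T k = 4 * e + 2 * u 0 + u 1"
    by (simp add: c e_def u_def T_def)
  have ur: "u r = tp (2 * k + r)" by (simp add: u_def)
  show ?thesis
  proof
    assume "step (pair_ntm M) (pair_config c) d"
    then obtain q1 b1 d1 where
      tr: "(pstate q r, 4 * e + 2 * u 0 + u 1, q1, b1, d1) \<in> trans (pair_ntm M)"
      and d: "d = (q1, move_head d1 k, T(k := b1))"
      unfolding pc step_triple_iff sym by blast
    from tr have "\<exists>e' v q' b d'. 4 * e + 2 * u 0 + u 1 = 4 * e' + 2 * v 0 + v 1 \<and>
      e' < 2 \<and> v 0 < 2 \<and> v 1 < 2 \<and> (q, v r, q', b, d') \<in> trans M \<and>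
      q1 = pstate q' (fst (pmove d' r e')) \<and> d1 = snd (pmove d' r e') \<and>
      b1 = 4 * e' + 2 * (v(r := b)) 0 + (v(r := b)) 1"
      by (cases rule: trans_pair_ntm_cases) (simp, simp only: prod.inject pstate_eq_iff, blast)
    then obtain e' v q' b d' where v: "4 * e + 2 * u 0 + u 1 = 4 * e' + 2 * v 0 + v 1"
      "e' < 2" "v 0 < 2" "v 1 < 2" "(q, v r, q', b, d') \<in> trans M"
      "q1 = pstate q' (fst (pmove d' r e'))" "d1 = snd (pmove d' r e')"
      "b1 = 4 * e' + 2 * (v(r := b)) 0 + (v(r := b)) 1"
      by blast
    have "u 0 < 2" "u 1 < 2" "e < 2" using bin by (auto simp: u_def e_def)
    \<comment> \<open>Uniqueness of binary digits, by running through the finitely many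
      cases.\<close>
    with v(1-4) have "e' = e \<and> v 0 = u 0 \<and> v 1 = u 1" 
      by (auto simp: less_2_cases_iff)
    then have eq: "e' = e" "v 0 = u 0" "v 1 = u 1" by blast+
    then have "v r = u r" "(v(r := b)) 0 = (u(r := b)) 0" "(v(r := b)) 1 = (u(r := b)) 1"
      using r01 by auto
    then have "d = pair_config (q', move_head d' (2 * k + r), tp(2 * k + r := b))"
      unfolding d v(6-8) eq T_def c by (subst upd) (simp_all add: u_def)
    moreover have "step M c (q', move_head d' (2 * k + r), tp(2 * k + r := b))"
      using v(5) unfolding c step_triple_iff \<open>v r = u r\<close> ur by blast
    ultimately show "\<exists>c'. d = pair_config c' \<and> step M c c'" by blast
  next
    assume "\<exists>c'. d = pair_config c' \<and> step M c c'"
    then obtain q' b d' where d: "d = pair_config (q', move_head d' (2 * k + r), tp(2 * k + r := b))"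
      and tr: "(q, u r, q', b, d') \<in> trans M"
      unfolding c step_triple_iff ur by blast
    have "u 0 < 2" "u 1 < 2" "e < 2" using bin by (auto simp: u_def e_def)
    then have "(pstate q r, 4 * e + 2 * u 0 + u 1, pstate q' (fst (pmove d' r e)),
         4 * e + 2 * (u(r := b)) 0 + (u(r := b)) 1, snd (pmove d' r e)) \<in> trans (pair_ntm M)"
      using tr r unfolding pair_ntm_def ntm.simps by blast
    moreover have "d = (pstate q' (fst (pmove d' r e)), move_head (snd (pmove d' r e)) k,
       T(k := 4 * e + 2 * (u(r := b)) 0 + (u(r := b)) 1))"
      unfolding d T_def c by (subst upd) (simp_all add: u_def)
    ultimately show "step (pair_ntm M) (pair_config c) d"
      unfolding pc step_triple_iff sym by blast
  qed
qed

lemma relpowp_pair_ntm_iff: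
  assumes "write_once_ntm M" "binary c"
  shows "(step (pair_ntm M) ^^ n) (pair_config c) d \<longleftrightarrow>
    (\<exists>c'. d = pair_config c' \<and> (step M ^^ n) c c' \<and> binary c')"
proof (induction n arbitrary: d)
  case 0
  then show ?case using assms(2) unfolding relpowp.simps by blast
next
  case (Suc n)
  have "(step (pair_ntm M) ^^ Suc n) (pair_config c) d \<longleftrightarrow>
    (\<exists>c'. (step M ^^ n) c c' \<and> binary c' \<and> step (pair_ntm M) (pair_config c') d)"
    unfolding relpowp.simps relcompp_apply Suc by blast
  also have "\<dots> \<longleftrightarrow> (\<exists>c' c''. (step M ^^ n) c c' \<and> binary c' \<and> d = pair_config c'' \<and> step M c' c'')"
    using step_pair_ntm_iff by blast
  also have "\<dots> \<longleftrightarrow> (\<exists>c''. d = pair_config c'' \<and> (step M ^^ Suc n) c c'' \<and> binary c'')"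
  proof -
    have "binary c''" if "(step M ^^ n) c c'" "step M c' c''" "binary c'" for c' c''
      using that binary_step(1)[OF assms(1)] by blast
    moreover note relpowp_binary[OF assms(1) _ assms(2)]
    ultimately show ?thesis unfolding relpowp.simps relcompp_apply by blast
  qed
  finally show ?case .
qed

text \<open>The additional step is the one that marks the left end. Acceptance without any step is
  impossible, as the start state 0 is not of the form \<open>pstate q p\<close>.\<close>

lemma accepts_in_pair_ntm:
  assumes "write_once_ntm M"
  shows "accepts_in (pair_ntm M) (ordinary_input w) n \<longleftrightarrow>
    (\<exists>m. n = Suc m \<and> accepts_in M (write_once_input w) m)"
proof -
  let ?i = "init_config M (write_once_input w)"
  have bin: "binary ?i"
    by (simp add: init_config_tape binary_def tape_write_once_input_less)
  have acc: "state_of (pair_config c) \<in> accepting (pair_ntm M) \<longleftrightarrow> state_of c \<in> accepting M" for c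
    by (cases c) (auto simp: pair_ntm_def state_of_def)
  have "step (pair_ntm M) (init_config (pair_ntm M) (ordinary_input w)) d \<longleftrightarrow> d = pair_config ?i" for d
  proof -
    have "tape (ordinary_input w) 0 < 4" using tape_ordinary_input_less[of w 0] by simp
    moreover have "pair_config ?i = (pstate (start M) 0, 0,
        (tape (ordinary_input w))(0 := tape (ordinary_input w) 0 + 4))"
      using tape_write_once_input[of w 0] tape_write_once_input[of w]
      by (auto simp: init_config_tape fun_eq_iff)
    ultimately show ?thesis
      by (auto simp: step_iff init_config_tape) (auto simp: pair_ntm_def)
  qed
  then have "(step (pair_ntm M) ^^ Suc m) (init_config (pair_ntm M) (ordinary_input w)) d \<longleftrightarrow>
      (step (pair_ntm M) ^^ m) (pair_config ?i) d" for m d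
    unfolding relpowp_Suc_left relcompp_apply by simp
  then have *: "accepts_in (pair_ntm M) (ordinary_input w) (Suc m) \<longleftrightarrow>
      (\<exists>c. (step M ^^ m) ?i c \<and> binary c \<and> state_of c \<in> accepting M)" for m
    unfolding accepts_in_def by (simp only: relpowp_pair_ntm_iff[OF assms bin]) (metis acc)
  have "accepts_in (pair_ntm M) (ordinary_input w) (Suc m) \<longleftrightarrow> accepts_in M (write_once_input w) m" for m
    unfolding * unfolding accepts_in_def using relpowp_binary[OF assms _ bin] by metis
  moreover have "\<not> accepts_in (pair_ntm M) (ordinary_input w) 0"
    by (auto simp: accepts_in_def init_config_tape state_of_def pair_ntm_def)
  ultimately show ?thesis by (cases n) blast+
qed

lemma NEXPWOSPACE_subset_NEXPTIME: "k_NEXPWOSPACE k \<subseteq> k_NEXPTIME k"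
proof
  fix L assume "L \<in> k_NEXPWOSPACE k"
  then obtain M t where M: "write_once_ntm M"
    and L: "L = {w. \<exists>cs. accepting_run M (write_once_input w) cs}"
    and sp: "\<And>w. w \<in> L \<Longrightarrow> 2 \<le> length w \<Longrightarrow> \<exists>cs. accepting_run M (write_once_input w) cs \<and>
                    run_space cs \<le> iter_exp k (length w ^ t)"
    unfolding k_NEXPWOSPACE_def by blast
  \<comment> \<open>The square of \<open>card (states M) * (s * Suc s)\<close> has degree 4 in
    \<open>s\<close>; the \<open>Suc\<close> pays for the step that marks the left end.\<close>
  define C where "C = Suc ((card (states M))\<^sup>2)"
  obtain t' where t': "\<And>n. 2 \<le> n \<Longrightarrow> C * (iter_exp k (n ^ t) + n) ^ 4 \<le> iter_exp k (n ^ t')"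
    using iter_exp_absorbs_polynomial by meson
  have "\<exists>cs. accepting_run (pair_ntm M) (ordinary_input w) cs \<and> run_time cs \<le> iter_exp k (length w ^ t')"
    if w: "w \<in> L" "2 \<le> length w" for w
  proof -
    let ?s = "iter_exp k (length w ^ t)"
    obtain cs where "accepting_run M (write_once_input w) cs" "run_space cs \<le> ?s"
      using sp w by blast
    from short_accepting_run[OF M this]
    obtain m where m: "accepts_in M (write_once_input w) m" "m \<le> (card (states M) * (?s * Suc ?s))\<^sup>2" .
    have "?s * Suc ?s \<le> (?s + length w)\<^sup>2"
      unfolding power2_eq_square using w(2) by (intro mult_le_mono) auto
    then have "card (states M) * (?s * Suc ?s) \<le> card (states M) * (?s + length w)\<^sup>2"
      by (rule mult_le_mono2)
    then have "(card (states M) * (?s * Suc ?s))\<^sup>2 \<le> (card (states M) * (?s + length w)\<^sup>2)\<^sup>2"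
      by (intro power_mono) auto
    also have "\<dots> = (card (states M))\<^sup>2 * (?s + length w) ^ 4"
      by (simp add: power_mult_distrib flip: power_mult)
    finally have "Suc m \<le> C * (?s + length w) ^ 4"
    proof -
      assume *: "(card (states M) * (?s * Suc ?s))\<^sup>2 \<le> (card (states M))\<^sup>2 * (?s + length w) ^ 4"
      have "1 \<le> (?s + length w) ^ 4" using w(2) by (intro one_le_power) auto
      then show ?thesis using * m(2) by (simp add: C_def)
    qed
    also have "\<dots> \<le> iter_exp k (length w ^ t')" using t' w(2) by blast
    finally have "Suc m \<le> iter_exp k (length w ^ t')" .
    then show ?thesis
      using m(1) accepts_in_pair_ntm[OF M, of w "Suc m"] by (auto simp: accepts_in_iff)
  qed
  moreover have "L = {w. \<exists>cs. accepting_run (pair_ntm M) (ordinary_input w) cs}"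
    unfolding L accepting_run_iff accepts_in_pair_ntm[OF M] by auto
  ultimately show "L \<in> k_NEXPTIME k"
    using ordinary_pair_ntm[OF M] unfolding k_NEXPTIME_def by blast
qed

section \<open>Regular programs and their compilation to write-once machines\<close>

text \<open>A nondeterministic machine is a finite automaton over its elementary instructions, so it
  can be given by a regular expression over sets of instructions.  The state of the simulated
  machine is kept as a register, which is why a program runs on configurations.\<close>

datatype prog =
    Skip
  | Act "(nat \<times> nat \<times> nat \<times> nat \<times> move) set"
  | Seq prog prog (infixr ";;" 60)
  | Alt prog prog
  | Star prog

definition act :: "(nat \<times> nat \<times> nat \<times> nat \<times> move) set \<Rightarrow> config \<Rightarrow> config \<Rightarrow> bool" where
  "act A c c' \<longleftrightarrow> (\<exists>q h tp q' b d. c = (q, h, tp) \<and> (q, tp h, q', b, d) \<in> A \<and>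
     c' = (q', move_head d h, tp(h := b)))"

lemma act_triple_iff:
  "act A (q, h, tp) c' \<longleftrightarrow>
    (\<exists>q' b d. (q, tp h, q', b, d) \<in> A \<and> c' = (q', move_head d h, tp(h := b)))"
  unfolding act_def prod.inject by metis

text \<open>The set \<open>H\<close> contains the positions which the head may visit.\<close>

primrec sem :: "nat set \<Rightarrow> prog \<Rightarrow> config \<Rightarrow> config \<Rightarrow> bool" where
  "sem H Skip = (=)"
| "sem H (Act A) = (\<lambda>c c'. act A c c' \<and> head_of c \<in> H \<and> head_of c' \<in> H)"
| "sem H (p ;; r) = sem H p OO sem H r"
| "sem H (Alt p r) = (\<lambda>c c'. sem H p c c' \<or> sem H r c c')"
| "sem H (Star p) = (sem H p)\<^sup>*\<^sup>*"

primrec acts :: "prog \<Rightarrow> (nat \<times> nat \<times> nat \<times> nat \<times> move) set" where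
  "acts Skip = {}"
| "acts (Act A) = A"
| "acts (p ;; r) = acts p \<union> acts r"
| "acts (Alt p r) = acts p \<union> acts r"
| "acts (Star p) = acts p"

definition good :: "nat set \<Rightarrow> nat \<Rightarrow> config \<Rightarrow> bool" where
  "good R g c \<longleftrightarrow> state_of c \<in> R \<and> (\<forall>i. snd (snd c) i < g)"

text \<open>The head position is carried along because \<open>Skip\<close> and an empty iteration of
  \<open>Star\<close> do not check membership in \<open>H\<close>.\<close>

lemma sem_good:
  assumes "acts p \<subseteq> R \<times> {..<g} \<times> R \<times> {..<g} \<times> UNIV" "sem H p c c'"
    "good R g c \<and> head_of c \<in> H"
  shows "good R g c' \<and> head_of c' \<in> H"
  using assms
proof (induction p arbitrary: c c')
  case (Act A)
  then show ?case by (cases c) (fastforce simp: good_def state_of_def act_triple_iff)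
next
  case (Star p)
  from Star.prems(2) have "(sem H p)\<^sup>*\<^sup>* c c'" by simp
  then show ?case using Star.prems(3)
    by (induction rule: rtranclp_induct) (use Star.IH Star.prems(1) in auto)
qed (simp; blast)+

text \<open>Programs have only a binary choice; the empty choice is \<open>Act {}\<close>, which
  always gets stuck.\<close>

lemma finite_choice_prog:
  assumes "finite X"
  shows "\<exists>p. acts p \<subseteq> (\<Union>x\<in>X. acts (f x)) \<and> (\<forall>H c c'. sem H p c c' \<longleftrightarrow> (\<exists>x\<in>X. sem H (f x) c c'))"
  using assms
proof induction
  case empty
  show ?case by (rule exI[of _ "Act {}"]) (simp add: act_def)
next
  case (insert x X)
  then obtain p where "acts p \<subseteq> (\<Union>x\<in>X. acts (f x))"
    "\<forall>H c c'. sem H p c c' \<longleftrightarrow> (\<exists>x\<in>X. sem H (f x) c c')" by blast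
  then show ?case by (intro exI[of _ "Alt (f x) p"]) auto
qed

text \<open>With two symbols, \<open>a \<le> b\<close> excludes exactly the erasure of a
  mark.\<close>

definition wo_acts :: "nat set \<Rightarrow> (nat \<times> nat \<times> nat \<times> nat \<times> move) set" where
  "wo_acts R = {(q, a, q', b, d). q \<in> R \<and> q' \<in> R \<and> a \<le> b \<and> b < 2}"

text \<open>Plays the role of an empty transition. Since an instruction must name the register and
  the symbol it reads, there is one for each combination.\<close>

definition noop :: "nat set \<Rightarrow> (nat \<times> nat \<times> nat \<times> nat \<times> move) set" where
  "noop R = {(q, a, q, a, Stay) | q a. q \<in> R \<and> a < 2}"

lemma act_noopD: "act (noop R) c c' \<Longrightarrow> c' = c"
  by (auto simp: act_def noop_def)

lemma act_noopI: "good R 2 c \<Longrightarrow> act (noop R) c c"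
  by (cases c) (auto simp: act_triple_iff noop_def good_def state_of_def intro!: exI[of _ Stay])

lemma noop_subset: "noop R \<subseteq> wo_acts R"
  by (auto simp: noop_def wo_acts_def)

type_synonym graph = "(nat \<times> (nat \<times> nat \<times> nat \<times> nat \<times> move) set \<times> nat) set"

definition gstep :: "nat set \<Rightarrow> graph \<Rightarrow> nat \<times> config \<Rightarrow> nat \<times> config \<Rightarrow> bool" where
  "gstep H E x y \<longleftrightarrow> (\<exists>A. (fst x, A, fst y) \<in> E \<and> act A (snd x) (snd y)) \<and>
     head_of (snd x) \<in> H \<and> head_of (snd y) \<in> H"

text \<open>Soundness is stated by assertions \<open>J u\<close> at the nodes, which compose more easily than paths.\<close>

definition implements :: "nat set \<Rightarrow> prog \<Rightarrow> graph \<Rightarrow> nat \<Rightarrow> nat \<Rightarrow> bool" where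
  "implements R p E s f \<longleftrightarrow>
     (\<forall>H c c'. good R 2 c \<and> head_of c \<in> H \<and> sem H p c c' \<longrightarrow> (gstep H E)\<^sup>*\<^sup>* (s, c) (f, c')) \<and>
     (\<forall>I. \<exists>J. I \<subseteq> J s \<and> J f \<subseteq> {c'. \<exists>c\<in>I. sem UNIV p c c'} \<and>
        (\<forall>u A v c c'. (u, A, v) \<in> E \<and> c \<in> J u \<and> act A c c' \<longrightarrow> c' \<in> J v))"

lemma implementsD1:
  "implements R p E s f \<Longrightarrow> good R 2 c \<and> head_of c \<in> H \<Longrightarrow> sem H p c c' \<Longrightarrow>
    (gstep H E)\<^sup>*\<^sup>* (s, c) (f, c')"
  unfolding implements_def by blast

lemma implementsD2:
  assumes "implements R p E s f"
  obtains J where "I \<subseteq> J s" "J f \<subseteq> {c'. \<exists>c\<in>I. sem UNIV p c c'}"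
    "\<And>u A v c c'. (u, A, v) \<in> E \<Longrightarrow> c \<in> J u \<Longrightarrow> act A c c' \<Longrightarrow> c' \<in> J v"
proof -
  from assms[unfolded implements_def, THEN conjunct2, THEN spec, of I]
  show thesis
  proof (elim exE conjE)
    fix J
    assume J: "I \<subseteq> J s" "J f \<subseteq> {c'. \<exists>c\<in>I. sem UNIV p c c'}"
      and "\<forall>u A v c c'. (u, A, v) \<in> E \<and> c \<in> J u \<and> act A c c' \<longrightarrow> c' \<in> J v"
    from this(3)[rule_format, OF conjI, OF _ conjI] show thesis by (rule that[OF J])
  qed
qed

lemma gstep_mono: "E \<subseteq> E' \<Longrightarrow> (gstep H E)\<^sup>*\<^sup>* x y \<Longrightarrow> (gstep H E')\<^sup>*\<^sup>* x y"
  by (rule rtranclp_mono[THEN predicate2D, of "gstep H E"])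
    (rule predicate2I, unfold gstep_def, blast)

lemma gstep_noop: "(u, noop R, v) \<in> E \<Longrightarrow> good R 2 c \<and> head_of c \<in> H \<Longrightarrow> (gstep H E)\<^sup>*\<^sup>* (u, c) (v, c)"
  by (intro r_into_rtranclp) (auto simp: gstep_def act_noopI)

lemma wo_acts_sub: "wo_acts R \<subseteq> R \<times> {..<2} \<times> R \<times> {..<2} \<times> UNIV"
  by (auto simp: wo_acts_def)

text \<open>Thompson's construction of an automaton from a regular expression, with
  \<open>noop\<close> for empty transitions. Nodes are taken from the interval from \<open>l\<close>
  to \<open>u\<close>, so that subprograms get disjoint node sets and their assertions can be merged
  by comparing node numbers.\<close>

lemma compile_prog:
  assumes "acts p \<subseteq> wo_acts R"
  shows "\<exists>u E s f. E \<subseteq> {l..<u} \<times> Pow (wo_acts R) \<times> {l..<u} \<and> s \<in> {l..<u} \<and> f \<in> {l..<u} \<and>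
    implements R p E s f"
  using assms
proof (induction p arbitrary: l)
  case Skip
  show ?case
    by (rule exI[of _ "Suc l"], rule exI[of _ "{}"], rule exI[of _ l], rule exI[of _ l])
      (auto simp: implements_def)
next
  case (Act A)
  have "implements R (Act A) {(l, A, Suc l)} l (Suc l)"
    unfolding implements_def
  proof (intro conjI allI impI)
    fix H c c' assume "good R 2 c \<and> head_of c \<in> H \<and> sem H (Act A) c c'"
    then show "(gstep H {(l, A, Suc l)})\<^sup>*\<^sup>* (l, c) (Suc l, c')"
      by (intro r_into_rtranclp) (auto simp: gstep_def)
  next
    fix I :: "config set"
    show "\<exists>J. I \<subseteq> J l \<and> J (Suc l) \<subseteq> {c'. \<exists>c\<in>I. sem UNIV (Act A) c c'} \<and>
        (\<forall>u X v c c'. (u, X, v) \<in> {(l, A, Suc l)} \<and> c \<in> J u \<and> act X c c' \<longrightarrow> c' \<in> J v)"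
      by (rule exI[of _ "\<lambda>u. if u = l then I else {c'. \<exists>c\<in>I. act A c c'}"]) auto
  qed
  with Act show ?case
    by (intro exI[of _ "Suc (Suc l)"] exI[of _ "{(l, A, Suc l)}"] exI[of _ l] exI[of _ "Suc l"]) auto
next
  case (Seq p1 p2)
  from Seq.prems have sub: "acts p1 \<subseteq> wo_acts R" "acts p2 \<subseteq> wo_acts R" by auto
  obtain u1 E1 s1 f1 where 1: "E1 \<subseteq> {l..<u1} \<times> Pow (wo_acts R) \<times> {l..<u1}" "s1 \<in> {l..<u1}" "f1 \<in> {l..<u1}"
    "implements R p1 E1 s1 f1" using Seq.IH(1)[OF sub(1), of l] by blast
  obtain u2 E2 s2 f2 where 2: "E2 \<subseteq> {u1..<u2} \<times> Pow (wo_acts R) \<times> {u1..<u2}" "s2 \<in> {u1..<u2}" "f2 \<in> {u1..<u2}"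
    "implements R p2 E2 s2 f2" using Seq.IH(2)[OF sub(2), of u1] by blast
  define E where "E = insert (f1, noop R, s2) (E1 \<union> E2)"
  have "implements R (p1 ;; p2) E s1 f2"
    unfolding implements_def
  proof (intro conjI allI impI)
    fix H c c' assume *: "good R 2 c \<and> head_of c \<in> H \<and> sem H (p1 ;; p2) c c'"
    then obtain c1 where c1: "sem H p1 c c1" "sem H p2 c1 c'" by auto
    have g: "good R 2 c1 \<and> head_of c1 \<in> H"
      using sem_good[OF order_trans[OF sub(1) wo_acts_sub] c1(1)] * by blast
    have "(gstep H E)\<^sup>*\<^sup>* (s1, c) (f1, c1)"
      by (rule gstep_mono[OF _ implementsD1[OF 1(4) _ c1(1)]]) (use * in \<open>auto simp: E_def\<close>)
    moreover have "(gstep H E)\<^sup>*\<^sup>* (f1, c1) (s2, c1)"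
      by (rule gstep_noop[OF _ g]) (simp add: E_def)
    moreover have "(gstep H E)\<^sup>*\<^sup>* (s2, c1) (f2, c')"
      by (rule gstep_mono[OF _ implementsD1[OF 2(4) g c1(2)]]) (auto simp: E_def)
    ultimately show "(gstep H E)\<^sup>*\<^sup>* (s1, c) (f2, c')" by (meson rtranclp_trans)
  next
    fix I :: "config set"
    obtain J1 where J1: "I \<subseteq> J1 s1" "J1 f1 \<subseteq> {c'. \<exists>c\<in>I. sem UNIV p1 c c'}"
      "\<And>u A v c c'. (u, A, v) \<in> E1 \<Longrightarrow> c \<in> J1 u \<Longrightarrow> act A c c' \<Longrightarrow> c' \<in> J1 v"
      using implementsD2[OF 1(4)] by blast
    obtain J2 where J2: "J1 f1 \<subseteq> J2 s2" "J2 f2 \<subseteq> {c'. \<exists>c\<in>J1 f1. sem UNIV p2 c c'}"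
      "\<And>u A v c c'. (u, A, v) \<in> E2 \<Longrightarrow> c \<in> J2 u \<Longrightarrow> act A c c' \<Longrightarrow> c' \<in> J2 v"
      using implementsD2[OF 2(4)] by blast
    \<comment> \<open>\<open>J2\<close> was chosen for the precondition \<open>J1 f1\<close>, so the
      connecting edge preserves the assertions.\<close>
    let ?J = "\<lambda>u. if u < u1 then J1 u else J2 u"
    have "c' \<in> ?J v" if e: "(u, A, v) \<in> E" and c: "c \<in> ?J u" "act A c c'" for u A v c c'
    proof -
      consider "(u, A, v) = (f1, noop R, s2)" | "(u, A, v) \<in> E1" | "(u, A, v) \<in> E2"
        using e by (auto simp: E_def)
      then show ?thesis
      proof cases
        case 1
        then have "c' = c" "u = f1" "v = s2" using c act_noopD by blast+
        then show ?thesis using c(1) \<open>f1 \<in> _\<close> \<open>s2 \<in> _\<close> J2(1) by auto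
      next
        case 2
        then have "u < u1" "v < u1" using 1(1) by auto
        then show ?thesis using c J1(3)[OF 2 _ c(2)] by simp
      next
        case 3
        then have "\<not> u < u1" "\<not> v < u1" using 2(1) by auto
        then show ?thesis using c J2(3)[OF 3 _ c(2)] by simp
      qed
    qed
    then show "\<exists>J. I \<subseteq> J s1 \<and> J f2 \<subseteq> {c'. \<exists>c\<in>I. sem UNIV (p1 ;; p2) c c'} \<and>
        (\<forall>u A v c c'. (u, A, v) \<in> E \<and> c \<in> J u \<and> act A c c' \<longrightarrow> c' \<in> J v)"
      using 1(2) 2(3) J1(1,2) J2(2) by (intro exI[of _ ?J]) (simp only: relcompp_apply sem.simps, fastforce)
  qed
  moreover have "E \<subseteq> {l..<u2} \<times> Pow (wo_acts R) \<times> {l..<u2}"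
    using 1(1-3) 2(1-3) noop_subset by (fastforce simp: E_def)
  ultimately show ?case using 1(2,3) 2(2,3)
    by (intro exI[of _ u2] exI[of _ E] exI[of _ s1] exI[of _ f2]) auto
next
  case (Alt p1 p2)
  from Alt.prems have sub: "acts p1 \<subseteq> wo_acts R" "acts p2 \<subseteq> wo_acts R" by auto
  obtain u1 E1 s1 f1 where 1: "E1 \<subseteq> {l..<u1} \<times> Pow (wo_acts R) \<times> {l..<u1}" "s1 \<in> {l..<u1}" "f1 \<in> {l..<u1}"
    "implements R p1 E1 s1 f1" using Alt.IH(1)[OF sub(1), of l] by blast
  obtain u2 E2 s2 f2 where 2: "E2 \<subseteq> {u1..<u2} \<times> Pow (wo_acts R) \<times> {u1..<u2}" "s2 \<in> {u1..<u2}" "f2 \<in> {u1..<u2}"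
    "implements R p2 E2 s2 f2" using Alt.IH(2)[OF sub(2), of u1] by blast
  \<comment> \<open>Two new nodes: \<open>u2\<close> is the common entry and \<open>Suc u2\<close>
    the common exit.\<close>
  define E where "E = {(u2, noop R, s1), (u2, noop R, s2), (f1, noop R, Suc u2), (f2, noop R, Suc u2)} \<union> (E1 \<union> E2)"
  have "implements R (Alt p1 p2) E u2 (Suc u2)"
    unfolding implements_def
  proof (intro conjI allI impI)
    fix H c c' assume *: "good R 2 c \<and> head_of c \<in> H \<and> sem H (Alt p1 p2) c c'"
    have "acts (Alt p1 p2) \<subseteq> R \<times> {..<2} \<times> R \<times> {..<2} \<times> UNIV"
      using Alt.prems wo_acts_sub by blast
    with * have g: "good R 2 c \<and> head_of c \<in> H" "good R 2 c' \<and> head_of c' \<in> H"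
      using sem_good by blast+
    have "(gstep H E)\<^sup>*\<^sup>* (u2, c) (s1, c)" "(gstep H E)\<^sup>*\<^sup>* (u2, c) (s2, c)"
      "(gstep H E)\<^sup>*\<^sup>* (f1, c') (Suc u2, c')" "(gstep H E)\<^sup>*\<^sup>* (f2, c') (Suc u2, c')"
      by (rule gstep_noop[OF _ g(1)] gstep_noop[OF _ g(2)]; simp add: E_def)+
    moreover have "(gstep H E)\<^sup>*\<^sup>* (s1, c) (f1, c') \<or> (gstep H E)\<^sup>*\<^sup>* (s2, c) (f2, c')"
    proof -
      consider "sem H p1 c c'" | "sem H p2 c c'" using * by auto
      then show ?thesis
      proof cases
        case 1
        have "(gstep H E)\<^sup>*\<^sup>* (s1, c) (f1, c')"
          by (rule gstep_mono[OF _ implementsD1[OF \<open>implements R p1 E1 s1 f1\<close> g(1) 1]]) (auto simp: E_def)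
        then show ?thesis ..
      next
        case 2
        have "(gstep H E)\<^sup>*\<^sup>* (s2, c) (f2, c')"
          by (rule gstep_mono[OF _ implementsD1[OF \<open>implements R p2 E2 s2 f2\<close> g(1) 2]]) (auto simp: E_def)
        then show ?thesis ..
      qed
    qed
    ultimately show "(gstep H E)\<^sup>*\<^sup>* (u2, c) (Suc u2, c')" by (meson rtranclp_trans)
  next
    fix I :: "config set"
    obtain J1 where J1: "I \<subseteq> J1 s1" "J1 f1 \<subseteq> {c'. \<exists>c\<in>I. sem UNIV p1 c c'}"
      "\<And>u A v c c'. (u, A, v) \<in> E1 \<Longrightarrow> c \<in> J1 u \<Longrightarrow> act A c c' \<Longrightarrow> c' \<in> J1 v"
      using implementsD2[OF 1(4)] by blast
    obtain J2 where J2: "I \<subseteq> J2 s2" "J2 f2 \<subseteq> {c'. \<exists>c\<in>I. sem UNIV p2 c c'}"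
      "\<And>u A v c c'. (u, A, v) \<in> E2 \<Longrightarrow> c \<in> J2 u \<Longrightarrow> act A c c' \<Longrightarrow> c' \<in> J2 v"
      using implementsD2[OF 2(4)] by blast
    let ?J = "\<lambda>u. if u < u1 then J1 u else if u < u2 then J2 u else if u = u2 then I else J1 f1 \<union> J2 f2"
    have "c' \<in> ?J v" if e: "(u, A, v) \<in> E" and c: "c \<in> ?J u" "act A c c'" for u A v c c'
    proof -
      consider "(u, A, v) = (u2, noop R, s1)" | "(u, A, v) = (u2, noop R, s2)"
        | "(u, A, v) = (f1, noop R, Suc u2)" | "(u, A, v) = (f2, noop R, Suc u2)"
        | "(u, A, v) \<in> E1" | "(u, A, v) \<in> E2"
        using e unfolding E_def by blast
      moreover have nc: "c' = c" if "A = noop R" using c(2) act_noopD that by blast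
      ultimately show ?thesis
      proof cases
        case 5
        then have "u < u1" "v < u1" using 1(1) by auto
        then show ?thesis using c J1(3)[OF 5 _ c(2)] by simp
      next
        case 6
        then have "\<not> u < u1" "u < u2" "\<not> v < u1" "v < u2" using 2(1) by auto
        then show ?thesis using c J2(3)[OF 6 _ c(2)] by simp
      qed (use c nc \<open>s1 \<in> _\<close> \<open>f1 \<in> _\<close> \<open>s2 \<in> _\<close> \<open>f2 \<in> _\<close> J1(1) J2(1) in auto)
    qed
    moreover have "u1 \<le> u2" using 2(2) by auto
    ultimately show "\<exists>J. I \<subseteq> J u2 \<and> J (Suc u2) \<subseteq> {c'. \<exists>c\<in>I. sem UNIV (Alt p1 p2) c c'} \<and>
        (\<forall>u A v c c'. (u, A, v) \<in> E \<and> c \<in> J u \<and> act A c c' \<longrightarrow> c' \<in> J v)"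
      using J1(2) J2(2) by (intro exI[of _ ?J]) (simp only: sem.simps, fastforce)
  qed
  moreover have "E \<subseteq> {l..<Suc (Suc u2)} \<times> Pow (wo_acts R) \<times> {l..<Suc (Suc u2)}"
    using 1(1-3) 2(1-3) noop_subset by (fastforce simp: E_def)
  ultimately show ?case using 1(2,3) 2(2,3)
    by (intro exI[of _ "Suc (Suc u2)"] exI[of _ E] exI[of _ u2] exI[of _ "Suc u2"]) auto
next
  case (Star p)
  from Star.prems have sub: "acts p \<subseteq> wo_acts R" by simp
  obtain u1 E1 s1 f1 where 1: "E1 \<subseteq> {Suc l..<u1} \<times> Pow (wo_acts R) \<times> {Suc l..<u1}" "s1 \<in> {Suc l..<u1}"
    "f1 \<in> {Suc l..<u1}" "implements R p E1 s1 f1" using Star.IH[OF sub, of "Suc l"] by blast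
  \<comment> \<open>The new node \<open>l\<close> is both entry and exit of the loop.\<close>
  define E where "E = {(l, noop R, s1), (f1, noop R, l)} \<union> E1"
  have "implements R (Star p) E l l"
    unfolding implements_def
  proof (intro conjI allI impI)
    fix H c c' assume *: "good R 2 c \<and> head_of c \<in> H \<and> sem H (Star p) c c'"
    then have "(sem H p)\<^sup>*\<^sup>* c c'" by simp
    then have "(gstep H E)\<^sup>*\<^sup>* (l, c) (l, c') \<and> good R 2 c' \<and> head_of c' \<in> H"
    proof (induction rule: rtranclp_induct)
      case (step c1 c2)
      then have g: "good R 2 c1 \<and> head_of c1 \<in> H" by blast
      then have g2: "good R 2 c2 \<and> head_of c2 \<in> H"
        using sem_good[OF order_trans[OF sub wo_acts_sub] step.hyps(2)] by blast
      have "(gstep H E)\<^sup>*\<^sup>* (l, c1) (s1, c1)" by (rule gstep_noop[OF _ g]) (simp add: E_def)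
      moreover have "(gstep H E)\<^sup>*\<^sup>* (s1, c1) (f1, c2)"
        by (rule gstep_mono[OF _ implementsD1[OF 1(4) g step.hyps(2)]]) (auto simp: E_def)
      moreover have "(gstep H E)\<^sup>*\<^sup>* (f1, c2) (l, c2)" by (rule gstep_noop[OF _ g2]) (simp add: E_def)
      ultimately show ?case using step.IH g2 by (meson rtranclp_trans)
    qed (use * in auto)
    then show "(gstep H E)\<^sup>*\<^sup>* (l, c) (l, c')" by blast
  next
    fix I :: "config set"
    \<comment> \<open>The loop invariant: everything reachable by iterating \<open>p\<close> from
      \<open>I\<close>. It is closed under one more round, as the edge from \<open>f1\<close> back
      to \<open>l\<close> demands.\<close>
    let ?I = "{c'. \<exists>c\<in>I. (sem UNIV p)\<^sup>*\<^sup>* c c'}"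
    obtain J1 where J1: "?I \<subseteq> J1 s1" "J1 f1 \<subseteq> {c'. \<exists>c\<in>?I. sem UNIV p c c'}"
      "\<And>u A v c c'. (u, A, v) \<in> E1 \<Longrightarrow> c \<in> J1 u \<Longrightarrow> act A c c' \<Longrightarrow> c' \<in> J1 v"
      using implementsD2[OF 1(4)] by blast
    have J1f: "J1 f1 \<subseteq> ?I"
    proof
      fix c' assume "c' \<in> J1 f1"
      then obtain c c1 where "c \<in> I" "(sem UNIV p)\<^sup>*\<^sup>* c c1" "sem UNIV p c1 c'" using J1(2) by blast
      then show "c' \<in> ?I" by (blast intro: rtranclp.rtrancl_into_rtrancl)
    qed
    let ?J = "\<lambda>u. if u = l then ?I else J1 u"
    have "c' \<in> ?J v" if e: "(u, A, v) \<in> E" and c: "c \<in> ?J u" "act A c c'" for u A v c c'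
    proof -
      consider "(u, A, v) = (l, noop R, s1)" | "(u, A, v) = (f1, noop R, l)" | "(u, A, v) \<in> E1"
        using e unfolding E_def by blast
      then show ?thesis
      proof cases
        case 1
        then have "c' = c" "u = l" "v = s1" using c act_noopD by auto
        then show ?thesis using c(1) J1(1) \<open>s1 \<in> _\<close> by auto
      next
        case 2
        then have "c' = c" "u = f1" "v = l" using c act_noopD by auto
        then show ?thesis using c(1) J1f 1(3) by auto
      next
        case 3
        then have "u \<noteq> l" "v \<noteq> l" using 1(1) by auto
        then show ?thesis using c J1(3)[OF 3 _ c(2)] by simp
      qed
    qed
    then have step: "\<forall>u A v c c'. (u, A, v) \<in> E \<and> c \<in> ?J u \<and> act A c c' \<longrightarrow> c' \<in> ?J v" by blast
    show "\<exists>J. I \<subseteq> J l \<and> J l \<subseteq> {c'. \<exists>c\<in>I. sem UNIV (Star p) c c'} \<and>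
        (\<forall>u A v c c'. (u, A, v) \<in> E \<and> c \<in> J u \<and> act A c c' \<longrightarrow> c' \<in> J v)"
      by (rule exI[of _ ?J], intro conjI step) auto
  qed
  moreover have "E \<subseteq> {l..<u1} \<times> Pow (wo_acts R) \<times> {l..<u1}"
    using 1(1-3) noop_subset by (fastforce simp: E_def)
  ultimately show ?case using 1(2,3)
    by (intro exI[of _ u1] exI[of _ E] exI[of _ l] exI[of _ l]) auto
qed

section \<open>From labelled graphs to write-once machines\<close>

definition node_config :: "nat \<times> config \<Rightarrow> config" where
  "node_config x = (prod_encode (fst x, fst (snd x)), snd (snd x))"

lemma node_config_eq_iff [simp]: "node_config x = node_config y \<longleftrightarrow> x = y"
  by (auto simp: node_config_def prod_eq_iff)

lemma head_of_node_config [simp]: "head_of (node_config x) = head_of (snd x)"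
  by (simp add: node_config_def head_of_def)

definition graph_ntm :: "nat set \<Rightarrow> nat \<Rightarrow> graph \<Rightarrow> nat \<Rightarrow> nat \<Rightarrow> nat \<Rightarrow> nat set \<Rightarrow> ntm" where
  "graph_ntm R u E s f q F = \<lparr>states = prod_encode ` ({..<u} \<times> R), num_syms = 2,
     start = prod_encode (s, q), accepting = (\<lambda>q. prod_encode (f, q)) ` F,
     trans = {(prod_encode (v, q), a, prod_encode (v', q'), b, d) | v q a v' q' b d.
       \<exists>A. (v, A, v') \<in> E \<and> (q, a, q', b, d) \<in> A}\<rparr>"

lemma step_graph_ntm_iff:
  "step (graph_ntm R u E s f q F) (node_config x) y \<longleftrightarrow>
    (\<exists>x'. y = node_config x' \<and> gstep UNIV E x x')"
proof -
  obtain v q0 h tp where x: "x = (v, q0, h, tp)" by (metis prod_cases4)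
  have "step (graph_ntm R u E s f q F) (node_config x) y \<longleftrightarrow>
    (\<exists>v' q' b d A. (v, A, v') \<in> E \<and> (q0, tp h, q', b, d) \<in> A \<and>
      y = (prod_encode (v', q'), move_head d h, tp(h := b)))"
    by (simp add: x node_config_def step_triple_iff graph_ntm_def) blast
  also have "\<dots> \<longleftrightarrow> (\<exists>x'. y = node_config x' \<and> gstep UNIV E x x')"
    unfolding x node_config_def gstep_def
    by (simp add: act_triple_iff) metis
  finally show ?thesis .
qed

text \<open>A machine state is a pair of a node and a register. Soundness carries the node
  assertions along the run, starting from the single initial configuration; for space it suffices
  that every head position lies in \<open>{..<S}\<close>. Position 0 is occupied even if no
  instruction is executed, hence \<open>0 < S\<close>.\<close>

theorem compile_write_once:
  assumes R: "finite R" "q \<in> R" "F \<subseteq> R" and p: "acts p \<subseteq> wo_acts R"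
  obtains M where "write_once_ntm M"
    "\<And>xs cs. accepting_run M xs cs \<Longrightarrow> \<exists>c. sem UNIV p (q, 0, tape xs) c \<and> state_of c \<in> F"
    "\<And>xs S c. \<forall>i. tape xs i < 2 \<Longrightarrow> sem {..<S} p (q, 0, tape xs) c \<Longrightarrow> state_of c \<in> F \<Longrightarrow> 0 < S \<Longrightarrow>
      \<exists>cs. accepting_run M xs cs \<and> run_space cs \<le> S"
proof -
  obtain u E s f where E: "E \<subseteq> {0..<u} \<times> Pow (wo_acts R) \<times> {0..<u}" "s \<in> {0..<u}" "f \<in> {0..<u}"
    "implements R p E s f"
    using compile_prog[OF p, of 0] by blast
  define M where "M = graph_ntm R u E s f q F"
  have init: "init_config M xs = node_config (s, q, 0, tape xs)" for xs
    by (simp add: init_config_tape M_def graph_ntm_def node_config_def)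
  have acc: "state_of (node_config x) \<in> accepting M \<longleftrightarrow> fst x = f \<and> state_of (snd x) \<in> F" for x
    by (auto simp: M_def graph_ntm_def node_config_def state_of_def)
  note step_iff' = step_graph_ntm_iff[of R u E s f q F, folded M_def]
  have "write_once_ntm M"
  proof -
    have "q1 \<in> R \<and> q2 \<in> R \<and> a < 2 \<and> b < 2 \<and> v < u \<and> v' < u \<and> a \<le> b"
      if "(v, A, v') \<in> E" "(q1, a, q2, b, d) \<in> A" for v A v' q1 q2 a b d
      using E(1) that by (fastforce simp: wo_acts_def)
    then have "trans M \<subseteq> states M \<times> {..<num_syms M} \<times> states M \<times> {..<num_syms M} \<times> UNIV"
      "(x, 1, x', 0, d) \<notin> trans M" for x x' d
      by (fastforce simp: M_def graph_ntm_def)+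
    then show ?thesis using R E(2,3)
      by (auto simp: write_once_ntm_def wf_ntm_def M_def graph_ntm_def)
  qed
  moreover have "\<exists>c. sem UNIV p (q, 0, tape xs) c \<and> state_of c \<in> F" if "accepting_run M xs cs" for xs cs
  proof -
    have cs: "cs \<noteq> []" "hd cs = node_config (s, q, 0, tape xs)" "successively (step M) cs"
      "state_of (last cs) \<in> accepting M"
      using that by (auto simp: accepting_run_def init)
    have "(step M)\<^sup>*\<^sup>* (hd cs) (last cs)"
      using relpowp_of_successively[OF cs(3,1)] unfolding rtranclp_power by blast
    then have run: "(step M)\<^sup>*\<^sup>* (node_config (s, q, 0, tape xs)) (last cs)" by (simp only: cs(2))
    obtain J where J: "{(q, 0, tape xs)} \<subseteq> J s" "J f \<subseteq> {c'. \<exists>c\<in>{(q, 0, tape xs)}. sem UNIV p c c'}"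
      "\<And>u A v c c'. (u, A, v) \<in> E \<Longrightarrow> c \<in> J u \<Longrightarrow> act A c c' \<Longrightarrow> c' \<in> J v"
      using implementsD2[OF E(4)] by blast
    from run have "\<exists>x. last cs = node_config x \<and> snd x \<in> J (fst x)"
    proof (induction rule: rtranclp_induct)
      case base
      then show ?case using J(1) by (intro exI[of _ "(s, q, 0, tape xs)"]) auto
    next
      case (step y z)
      then obtain x x' where "y = node_config x" "snd x \<in> J (fst x)" "z = node_config x'" "gstep UNIV E x x'"
        using step_iff' by blast
      then show ?case using J(3) unfolding gstep_def by blast
    qed
    then obtain x where x: "last cs = node_config x" "snd x \<in> J (fst x)" by blast
    with cs(4) have "fst x = f" "state_of (snd x) \<in> F" using acc by simp_all
    then show ?thesis using x(2) J(2) by blast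
  qed
  moreover have "\<exists>cs. accepting_run M xs cs \<and> run_space cs \<le> S"
    if bin: "\<forall>i. tape xs i < 2" and c: "sem {..<S} p (q, 0, tape xs) c" "state_of c \<in> F" and S: "0 < S" for xs S c
  proof -
    have "(gstep {..<S} E)\<^sup>*\<^sup>* (s, q, 0, tape xs) (f, c)"
      by (rule implementsD1[OF E(4) _ c(1)])
        (use bin S R in \<open>auto simp: good_def state_of_def head_of_def\<close>)
    then obtain n where "(gstep {..<S} E ^^ n) (s, q, 0, tape xs) (f, c)"
      using rtranclp_imp_relpowp by metis
    then obtain xs' where xs': "xs' \<noteq> []" "hd xs' = (s, q, 0, tape xs)" "last xs' = (f, c)"
      "successively (gstep {..<S} E) xs'" "length xs' = Suc n" by (rule successively_of_relpowp)
    let ?cs = "map node_config xs'"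
    have "successively (step M) ?cs"
      unfolding successively_map
      by (rule successively_mono[OF xs'(4)]) (auto simp: step_iff' gstep_def)
    then have "accepting_run M xs ?cs"
      using xs' c(2) by (simp add: accepting_run_def hd_map last_map init acc)
    moreover have "head_of (snd x) < S" if "x \<in> set xs'" for x
    proof -
      from that obtain i where i: "i < length xs'" "x = xs' ! i" by (auto simp: in_set_conv_nth)
      show ?thesis
      proof (cases i)
        case 0
        then show ?thesis using xs'(1,2) i S by (simp add: hd_conv_nth head_of_def)
      next
        case (Suc j)
        then have "gstep {..<S} E (xs' ! j) (xs' ! Suc j)" using xs'(4) i by (simp add: successively_conv_nth)
        then show ?thesis using i Suc by (simp add: gstep_def)
      qed
    qed
    then have "head_of ` set ?cs \<subseteq> {..<S}" by auto
    from card_mono[OF _ this] have "run_space ?cs \<le> S" by (simp add: run_space_def)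
    ultimately show ?thesis by blast
  qed
  ultimately show thesis by (rule that)
qed

section \<open>Two cells per symbol\<close>

fun split_config :: "config \<Rightarrow> config" where
  "split_config (q, h, tp) = (q, 2 * h, \<lambda>i. if even i then tp (i div 2) div 2 else tp (i div 2) mod 2)"

text \<open>Both binary digits of the symbol may only grow, so 0 may become anything, 1 and 2 may
  become 3, and 1 and 2 cannot be exchanged.\<close>

definition pair_acts :: "nat set \<Rightarrow> (nat \<times> nat \<times> nat \<times> nat \<times> move) set" where
  "pair_acts R = {(q, a, q', b, d). q \<in> R \<and> q' \<in> R \<and> a < 4 \<and> b < 4 \<and> a div 2 \<le> b div 2 \<and> a mod 2 \<le> b mod 2}"

definition shift :: "nat \<Rightarrow> move \<Rightarrow> prog" where
  "shift q d = Act {(q, a, q, a, d) | a. a < 2}"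

lemma sem_shift_iff:
  "sem H (shift q d) (q0, h, tp) c' \<longleftrightarrow>
    q0 = q \<and> tp h < 2 \<and> c' = (q, move_head d h, tp) \<and> h \<in> H \<and> move_head d h \<in> H"
  by (auto simp: shift_def act_triple_iff head_of_def)

text \<open>The high digit is treated first, then the low one, and the left move returns to the even
  cell, from which a move of the simulated head is two moves in direction \<open>d\<close>; this is
  correct at the left end too, as both are truncated. A wrong guess of the instruction gets stuck at
  one of the two reads.\<close>

fun bits :: "nat \<times> nat \<times> nat \<times> nat \<times> move \<Rightarrow> prog" where
  "bits (q, a, q', b, d) = Act {(q, a div 2, q, b div 2, MoveRight)} ;;
     Act {(q, a mod 2, q', b mod 2, MoveLeft)} ;; shift q' d ;; shift q' d"

lemma split_config_upd:
  "split_config (q', h', tp(h := b)) =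
    (q', 2 * h', (snd (snd (split_config (q, h, tp))))(2 * h := b div 2, Suc (2 * h) := b mod 2))"
  by (auto simp: fun_eq_iff elim!: evenE oddE)

lemma move_head_twice: "move_head d (move_head d (2 * h)) = 2 * move_head d h"
  by (cases d) auto

lemma bits_sound:
  assumes "sem UNIV (bits x) (split_config c) e"
  shows "\<exists>c'. e = split_config c' \<and> act {x} c c'"
proof -
  obtain q a q' b d where x: "x = (q, a, q', b, d)" by (metis prod_cases5)
  obtain q0 h tp where c: "c = (q0, h, tp)" by (metis prod_cases3)
  define T where "T = snd (snd (split_config c))"
  have T: "split_config c = (q0, 2 * h, T)" "T (2 * h) = tp h div 2" "T (Suc (2 * h)) = tp h mod 2"
    by (simp_all add: T_def c)
  have e: "q0 = q" "tp h div 2 = a div 2" "tp h mod 2 = a mod 2"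
    "e = (q', move_head d (move_head d (2 * h)), T(2 * h := b div 2, Suc (2 * h) := b mod 2))"
    using assms by (auto simp: x T sem_shift_iff act_triple_iff)
  from e(2,3) have "tp h = a" by (metis div_mult_mod_eq)
  moreover note e(1) e(4)[unfolded move_head_twice]
  ultimately have "e = split_config (q', move_head d h, tp(h := b))" "act {x} c (q', move_head d h, tp(h := b))"
    using split_config_upd[of q' "move_head d h" tp h b q0, folded c, folded T_def]
    by (simp_all only:) (simp add: x c act_triple_iff)
  then show ?thesis by blast
qed

lemma bits_complete:
  assumes "sem {..<S} (Act {x}) c c'" "good R 4 c" "x \<in> pair_acts R"
  shows "sem {..<2 * S} (bits x) (split_config c) (split_config c')"
proof -
  obtain q a q' b d where x: "x = (q, a, q', b, d)" by (metis prod_cases5)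
  obtain q0 h tp where c: "c = (q0, h, tp)" by (metis prod_cases3)
  define T where "T = snd (snd (split_config c))"
  have T: "split_config c = (q0, 2 * h, T)" "T (2 * h) = tp h div 2" "T (Suc (2 * h)) = tp h mod 2"
    by (simp_all add: T_def c)
  have lt: "T i < 2" for i
    using assms(2) by (simp add: T_def c good_def) (metis less_mult_imp_div_less mult_2_right numeral_Bit0)
  define T' where "T' = T(2 * h := b div 2, Suc (2 * h) := b mod 2)"
  have b: "b < 4" using assms(3) by (simp add: x pair_acts_def)
  have lt': "T' i < 2" for i using lt b by (auto simp: T'_def)
  have *: "q0 = q" "tp h = a" "c' = (q', move_head d h, tp(h := b))" "h < S" "move_head d h < S"
    using assms(1) by (auto simp: x c act_triple_iff head_of_def)
  have c': "split_config c' = (q', move_head d (move_head d (2 * h)), T')"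
    unfolding * move_head_twice T'_def T_def c by (rule split_config_upd)
  have "sem {..<2 * S} (Act {(q, a div 2, q, b div 2, MoveRight)}) (split_config c) (q, Suc (2 * h), T(2 * h := b div 2))"
    using * by (simp add: T act_triple_iff head_of_def)
  moreover have "sem {..<2 * S} (Act {(q, a mod 2, q', b mod 2, MoveLeft)}) (q, Suc (2 * h), T(2 * h := b div 2)) (q', 2 * h, T')"
    using * T by (simp add: act_triple_iff head_of_def T'_def)
  moreover have "sem {..<2 * S} (shift q' d) (q', 2 * h, T') (q', move_head d (2 * h), T')"
  proof -
    have "move_head d (2 * h) < 2 * S" using *(4,5) by (cases d) auto
    then show ?thesis using lt' *(4) by (simp add: sem_shift_iff)
  qed
  moreover have "sem {..<2 * S} (shift q' d) (q', move_head d (2 * h), T') (split_config c')"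
  proof -
    have "move_head d (2 * h) < 2 * S" using *(4,5) by (cases d) auto
    moreover have "move_head d (move_head d (2 * h)) < 2 * S" using *(5) by (simp add: move_head_twice)
    ultimately show ?thesis using lt' by (simp add: sem_shift_iff c')
  qed
  ultimately show ?thesis unfolding x bits.simps sem.simps(3) by blast
qed

lemma acts_bits: "x \<in> pair_acts R \<Longrightarrow> acts (bits x) \<subseteq> wo_acts R"
  by (cases x) (auto simp: pair_acts_def wo_acts_def shift_def)

lemma finite_UNIV_move: "finite (UNIV :: move set)"
proof -
  have "(UNIV :: move set) = {MoveLeft, Stay, MoveRight}" using move.exhaust by auto
  then show ?thesis by (metis finite.simps)
qed

lemma finite_pair_acts:
  assumes "finite R"
  shows "finite (pair_acts R)"
proof (rule finite_subset)
  show "finite (R \<times> {..<4::nat} \<times> R \<times> {..<4::nat} \<times> (UNIV :: move set))"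
    using assms finite_UNIV_move by simp
qed (auto simp: pair_acts_def)

text \<open>Only \<open>Act\<close> needs work, namely a choice among its finitely many
  instructions. The other cases compose because every result of a translated program is again a
  \<open>split_config\<close>.\<close>

lemma realize_pair_prog:
  assumes R: "finite R" and "acts p \<subseteq> pair_acts R"
  shows "\<exists>p'. acts p' \<subseteq> wo_acts R \<and>
    (\<forall>S c c'. good R 4 c \<and> head_of c \<in> {..<S} \<and> sem {..<S} p c c' \<longrightarrow>
      sem {..<2 * S} p' (split_config c) (split_config c')) \<and>
    (\<forall>c e. sem UNIV p' (split_config c) e \<longrightarrow> (\<exists>c'. e = split_config c' \<and> sem UNIV p c c'))"
    (is "\<exists>p'. ?real p p'")
  using assms(2)
proof (induction p)
  case Skip
  show ?case by (intro exI[of _ Skip]) auto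
next
  case (Act A)
  have "finite A" using Act finite_subset finite_pair_acts[OF R] by auto
  from finite_choice_prog[OF this, of bits] obtain p' where p': "acts p' \<subseteq> (\<Union>x\<in>A. acts (bits x))"
    "\<And>H c c'. sem H p' c c' \<longleftrightarrow> (\<exists>x\<in>A. sem H (bits x) c c')" by blast
  have A: "act A c c' \<longleftrightarrow> (\<exists>x\<in>A. act {x} c c')" for c c'
    unfolding act_def by blast
  have "acts p' \<subseteq> wo_acts R"
    by (rule order_trans[OF p'(1)], rule UN_least, rule acts_bits) (use Act in auto)
  moreover have "\<exists>x\<in>A. sem {..<S} (Act {x}) c c'" if "sem {..<S} (Act A) c c'" for S c c'
    using that A by auto
  then have "sem {..<2 * S} p' (split_config c) (split_config c')" if "good R 4 c" "sem {..<S} (Act A) c c'" for S c c'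
    unfolding p'(2) using that bits_complete Act by (metis acts.simps(2) subsetD)
  moreover have "\<exists>c'. e = split_config c' \<and> sem UNIV (Act A) c c'" if "sem UNIV p' (split_config c) e" for c e
  proof -
    from that obtain x where "x \<in> A" "sem UNIV (bits x) (split_config c) e" unfolding p'(2) by blast
    with bits_sound obtain c' where "e = split_config c'" "act {x} c c'" by blast
    moreover from this have "sem UNIV (Act A) c c'" using A \<open>x \<in> A\<close> by (simp only: sem.simps) blast
    ultimately show ?thesis by blast
  qed
  ultimately show ?case by blast
next
  case (Seq p1 p2)
  from Seq.prems have sub: "acts p1 \<subseteq> pair_acts R" "acts p2 \<subseteq> pair_acts R" by auto
  from Seq.IH(1)[OF sub(1)] obtain r1 where r1: "?real p1 r1" ..
  from Seq.IH(2)[OF sub(2)] obtain r2 where r2: "?real p2 r2" ..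
  have good: "good R 4 c' \<and> head_of c' \<in> H" if "good R 4 c \<and> head_of c \<in> H" "sem H p1 c c'" for H c c'
    by (rule sem_good[OF _ that(2,1)]) (use sub in \<open>auto simp: pair_acts_def\<close>)
  have "sem {..<2 * S} (r1 ;; r2) (split_config c) (split_config c')"
    if "good R 4 c \<and> head_of c \<in> {..<S} \<and> sem {..<S} (p1 ;; p2) c c'" for S c c'
    using that good r1 r2 unfolding sem.simps relcompp_apply by meson
  moreover have "\<exists>c'. e = split_config c' \<and> sem UNIV (p1 ;; p2) c c'"
    if "sem UNIV (r1 ;; r2) (split_config c) e" for c e
    using that r1 r2 unfolding sem.simps relcompp_apply by metis
  ultimately show ?case using r1 r2 by (intro exI[of _ "r1 ;; r2"]) simp
next
  case (Alt p1 p2)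
  from Alt.prems have sub: "acts p1 \<subseteq> pair_acts R" "acts p2 \<subseteq> pair_acts R" by auto
  from Alt.IH(1)[OF sub(1)] obtain r1 where r1: "?real p1 r1" ..
  from Alt.IH(2)[OF sub(2)] obtain r2 where r2: "?real p2 r2" ..
  have "sem {..<2 * S} (Alt r1 r2) (split_config c) (split_config c')"
    if "good R 4 c \<and> head_of c \<in> {..<S} \<and> sem {..<S} (Alt p1 p2) c c'" for S c c'
    using that r1 r2 unfolding sem.simps by meson
  moreover have "\<exists>c'. e = split_config c' \<and> sem UNIV (Alt p1 p2) c c'"
    if "sem UNIV (Alt r1 r2) (split_config c) e" for c e
    using that r1 r2 unfolding sem.simps by metis
  ultimately show ?case using r1 r2 by (intro exI[of _ "Alt r1 r2"]) simp
next
  case (Star p)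
  from Star.prems have sub: "acts p \<subseteq> pair_acts R" by simp
  from Star.IH[OF sub] obtain r where r: "?real p r" ..
  have good: "good R 4 c' \<and> head_of c' \<in> H" if "good R 4 c \<and> head_of c \<in> H" "sem H p c c'" for H c c'
    by (rule sem_good[OF _ that(2,1)]) (use sub in \<open>auto simp: pair_acts_def\<close>)
  have "(sem {..<2 * S} r)\<^sup>*\<^sup>* (split_config c) (split_config c')"
    if g: "good R 4 c \<and> head_of c \<in> {..<S}" and s: "(sem {..<S} p)\<^sup>*\<^sup>* c c'" for S c c'
  proof -
    from s have "(sem {..<2 * S} r)\<^sup>*\<^sup>* (split_config c) (split_config c') \<and> good R 4 c' \<and> head_of c' \<in> {..<S}"
    proof (induction rule: rtranclp_induct)
      case (step y z)
      then have "sem {..<2 * S} r (split_config y) (split_config z)" "good R 4 z \<and> head_of z \<in> {..<S}"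
        using r good[of y "{..<S}" z] by blast+
      with step.IH show ?case by (meson rtranclp.rtrancl_into_rtrancl)
    qed (use g in auto)
    then show ?thesis by blast
  qed
  moreover have "\<exists>c'. e = split_config c' \<and> (sem UNIV p)\<^sup>*\<^sup>* c c'"
    if "(sem UNIV r)\<^sup>*\<^sup>* (split_config c) e" for c e
    using that
  proof (induction rule: rtranclp_induct)
    case (step y z)
    then show ?case using r by (meson rtranclp.rtrancl_into_rtrancl)
  qed blast
  ultimately show ?case using r unfolding sem.simps by (intro exI[of _ "Star r"]) simp
qed

lemma state_of_split_config: "state_of (split_config c) = state_of c"
  by (cases c) (simp add: state_of_def)

text \<open>Splitting the cells of the ordinary input yields precisely the write-once input, so
  programs over four symbols may assume the input symbols 1 and 2.\<close>

theorem write_once_of_pair_prog: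
  assumes R: "finite R" "q \<in> R" "F \<subseteq> R" and p: "acts p \<subseteq> pair_acts R"
  obtains M where "write_once_ntm M"
    "\<And>w cs. accepting_run M (write_once_input w) cs \<Longrightarrow>
      \<exists>c. sem UNIV p (q, 0, tape (ordinary_input w)) c \<and> state_of c \<in> F"
    "\<And>w S c. sem {..<S} p (q, 0, tape (ordinary_input w)) c \<Longrightarrow> state_of c \<in> F \<Longrightarrow> 0 < S \<Longrightarrow>
      \<exists>cs. accepting_run M (write_once_input w) cs \<and> run_space cs \<le> 2 * S"
proof -
  have init: "(q, 0, tape (write_once_input w)) = split_config (q, 0, tape (ordinary_input w))" for w
  proof -
    have "tape (write_once_input w) i = (if even i then tape (ordinary_input w) (i div 2) div 2
        else tape (ordinary_input w) (i div 2) mod 2)" for i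
      using tape_write_once_input[of w "i div 2"] by (cases "even i") auto
    then show ?thesis by auto
  qed
  obtain r where r: "acts r \<subseteq> wo_acts R"
    "\<And>S c c'. good R 4 c \<and> head_of c \<in> {..<S} \<and> sem {..<S} p c c' \<Longrightarrow>
      sem {..<2 * S} r (split_config c) (split_config c')"
    "\<And>c e. sem UNIV r (split_config c) e \<Longrightarrow> \<exists>c'. e = split_config c' \<and> sem UNIV p c c'"
    using realize_pair_prog[OF R(1) p] by blast
  obtain M where M: "write_once_ntm M"
    "\<And>xs cs. accepting_run M xs cs \<Longrightarrow> \<exists>c. sem UNIV r (q, 0, tape xs) c \<and> state_of c \<in> F"
    "\<And>xs S c. \<forall>i. tape xs i < 2 \<Longrightarrow> sem {..<S} r (q, 0, tape xs) c \<Longrightarrow> state_of c \<in> F \<Longrightarrow> 0 < S \<Longrightarrow>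
      \<exists>cs. accepting_run M xs cs \<and> run_space cs \<le> S"
    using compile_write_once[OF R r(1)] by blast
  show thesis
  proof (rule that[OF M(1)])
    fix w cs assume "accepting_run M (write_once_input w) cs"
    from M(2)[OF this] show "\<exists>c. sem UNIV p (q, 0, tape (ordinary_input w)) c \<and> state_of c \<in> F"
      unfolding init using r(3) state_of_split_config by metis
  next
    fix w S c
    assume c: "sem {..<S} p (q, 0, tape (ordinary_input w)) c" "state_of c \<in> F" "0 < S"
    have "good R 4 (q, 0, tape (ordinary_input w))"
      using R tape_ordinary_input_less[of w] by (auto simp: good_def state_of_def intro: less_trans)
    then have "sem {..<2 * S} r (q, 0, tape (write_once_input w)) (split_config c)"
      unfolding init by (intro r(2)) (use c in \<open>simp add: head_of_def\<close>)
    from M(3)[OF _ this] c show "\<exists>cs. accepting_run M (write_once_input w) cs \<and> run_space cs \<le> 2 * S"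
      by (simp add: state_of_split_config tape_write_once_input_less)
  qed
qed

section \<open>Simulating an ordinary machine without erasing\<close>

lemma tape_append: "tape (xs @ ys) i = (if i < length xs then tape xs i else tape ys (i - length xs))"
  by (auto simp: tape_def nth_append)

lemma tape_Cons: "tape (x # xs) i = (if i = 0 then x else tape xs (i - 1))"
  by (auto simp: tape_def nth_Cons')

lemma tape_replicate: "tape (replicate n x) i = (if i < n then x else 0)"
  by (simp add: tape_def)

lemma tape_snoc_0: "tape (xs @ [0]) = tape xs"
  by (auto simp: tape_def nth_append fun_eq_iff)

lemma tape_ge: "length xs \<le> i \<Longrightarrow> tape xs i = 0"
  by (simp add: tape_def)

lemma tape_at: "tape (l @ x # r) (length l) = x"
  by (simp add: tape_def)

lemma tape_segment: "length l \<le> i \<Longrightarrow> i < length l + length s \<Longrightarrow> tape (l @ s @ r) i \<in> set s"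
  by (auto simp: tape_def nth_append)

lemma tape_upd: "(tape (l @ x # r))(length l := y) = tape (l @ y # r)"
  by (auto simp: tape_def nth_append fun_eq_iff nth_Cons')

lemma tape_upd_end: "(tape l)(length l := y) = tape (l @ [y])"
  by (auto simp: tape_def nth_append fun_eq_iff)

section \<open>Scanning and overwriting loops\<close>

definition go :: "nat set \<Rightarrow> nat set \<Rightarrow> move \<Rightarrow> prog" where
  "go R X d = Act {(q, x, q, x, d) | q x. q \<in> R \<and> x \<in> X}"

definition put :: "nat set \<Rightarrow> nat \<Rightarrow> nat \<Rightarrow> prog" where
  "put R x y = Act {(q, x, q, y, MoveRight) | q. q \<in> R}"

primrec rep :: "nat \<Rightarrow> prog \<Rightarrow> prog" where
  "rep 0 p = Skip"
| "rep (Suc n) p = rep n p ;; p"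

lemma sem_rep: "sem H (rep n p) = sem H p ^^ n"
  by (induction n) auto

lemma relpowp_relpowp:
  fixes P :: "'a \<Rightarrow> 'a \<Rightarrow> bool"
  shows "(P ^^ g) ^^ j = P ^^ (g * j)"
  by (induction j) (simp_all only: relpowp.simps mult_0_right mult_Suc_right add.commute[of g] relpowp_add)

lemma sem_Star_iff: "sem H (Star p) c c' \<longleftrightarrow> (\<exists>n. (sem H p ^^ n) c c')"
  by (simp add: rtranclp_power)

lemma sem_go:
  "sem H (go R X d) (q, h, tp) c' \<longleftrightarrow>
    q \<in> R \<and> tp h \<in> X \<and> c' = (q, move_head d h, tp) \<and> h \<in> H \<and> move_head d h \<in> H"
  by (auto simp: go_def act_triple_iff head_of_def)

lemma sem_put:
  "sem H (put R x y) (q, h, tp) c' \<longleftrightarrow>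
    q \<in> R \<and> tp h = x \<and> c' = (q, Suc h, tp(h := y)) \<and> h \<in> H \<and> Suc h \<in> H"
  by (auto simp: put_def act_triple_iff head_of_def)

lemma go_right_power:
  assumes "q \<in> R"
  shows "(sem H (go R X MoveRight) ^^ n) (q, h, tp) c' \<longleftrightarrow>
    (\<forall>i<n. tp (h + i) \<in> X) \<and> c' = (q, h + n, tp) \<and> (0 < n \<longrightarrow> {h..h + n} \<subseteq> H)"
proof (induction n arbitrary: c')
  case (Suc n)
  have "{h..Suc (h + n)} = insert (Suc (h + n)) {h..h + n}" by auto
  then show ?case
    unfolding relpowp.simps relcompp_apply Suc using assms
    by (cases n) (auto simp: sem_go less_Suc_eq)
qed auto

lemma go_left_power:
  assumes "q \<in> R"
  shows "(sem H (go R X MoveLeft) ^^ n) (q, h, tp) c' \<longleftrightarrow>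
    (\<forall>i<n. tp (h - i) \<in> X) \<and> c' = (q, h - n, tp) \<and> (0 < n \<longrightarrow> {h - n..h} \<subseteq> H)"
proof (induction n arbitrary: c')
  case (Suc n)
  have "{h - Suc n..h} = insert (h - Suc n) {h - n..h}" by auto
  then show ?case
    unfolding relpowp.simps relcompp_apply Suc using assms
    by (cases n) (auto simp: sem_go less_Suc_eq)
qed auto

lemma put_power:
  assumes "q \<in> R"
  shows "(sem H (put R x y) ^^ n) (q, h, tp) c' \<longleftrightarrow>
    (\<forall>i<n. tp (h + i) = x) \<and> c' = (q, h + n, \<lambda>i. if h \<le> i \<and> i < h + n then y else tp i) \<and>
    (0 < n \<longrightarrow> {h..h + n} \<subseteq> H)"
proof (induction n arbitrary: c')
  case (Suc n)
  have "{h..Suc (h + n)} = insert (Suc (h + n)) {h..h + n}" by auto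
  moreover have "(\<lambda>i. if h \<le> i \<and> i < h + n then y else tp i)(h + n := y) =
      (\<lambda>i. if h \<le> i \<and> i < h + Suc n then y else tp i)"
    by (auto simp: fun_eq_iff)
  ultimately show ?case
    unfolding relpowp.simps relcompp_apply Suc using assms
    by (cases n) (auto simp: sem_put less_Suc_eq)
qed auto

text \<open>Writing \<open>x\<close> over \<open>x\<close> is a mere scan, so only the second loop
  changes the tape. The condition \<open>0 < k\<close> makes the constraint on \<open>H\<close> for
  the second range unconditional.\<close>

lemma put_power_twice:
  assumes q: "q \<in> R" and k: "0 < k"
  shows "(sem H (put R x x) ^^ n OO sem H (put R y x) ^^ k) (q, h, tp) c' \<longleftrightarrow>
    (\<forall>i<n. tp (h + i) = x) \<and> (\<forall>i<k. tp (h + n + i) = y) \<and> (0 < n \<longrightarrow> {h..h + n} \<subseteq> H) \<and>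
    {h + n..h + n + k} \<subseteq> H \<and> c' = (q, h + n + k, \<lambda>i. if h + n \<le> i \<and> i < h + n + k then x else tp i)"
proof (cases "\<forall>i<n. tp (h + i) = x")
  case True
  then have "(\<lambda>i. if h \<le> i \<and> i < h + n then x else tp i) = tp"
    by (auto simp: fun_eq_iff dest: le_Suc_ex)
  with True k show ?thesis by (auto simp add: relcompp_apply put_power[OF q])
next
  case False
  then show ?thesis by (auto simp add: relcompp_apply put_power[OF q])
qed

text \<open>A loop may stop anywhere, but by \<open>req\<close> the continuation cannot start on a
  symbol of \<open>X\<close>, while the loop cannot pass one outside \<open>X\<close>. So the
  nondeterministic loop has exactly one useful length.\<close>

lemma walk_right:
  assumes "q \<in> R" "h \<le> h'" "{..h'} \<subseteq> H"
    and "\<And>i. h \<le> i \<Longrightarrow> i < h' \<Longrightarrow> tp i \<in> X" "tp h' \<notin> X"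
    and req: "\<And>i e. sem H p (q, i, tp) e \<Longrightarrow> tp i \<notin> X"
  shows "sem H (Star (go R X MoveRight) ;; p) (q, h, tp) c' \<longleftrightarrow> sem H p (q, h', tp) c'"
proof
  assume "sem H p (q, h', tp) c'"
  moreover have "sem H (Star (go R X MoveRight)) (q, h, tp) (q, h', tp)"
    unfolding sem_Star_iff go_right_power[OF assms(1)]
    by (rule exI[of _ "h' - h"]) (use assms(2-4) in auto)
  ultimately show "sem H (Star (go R X MoveRight) ;; p) (q, h, tp) c'" by auto
next
  assume "sem H (Star (go R X MoveRight) ;; p) (q, h, tp) c'"
  then obtain n where n: "\<forall>i<n. tp (h + i) \<in> X" "sem H p (q, h + n, tp) c'"
    by (auto simp only: sem.simps(3) relcompp_apply sem_Star_iff go_right_power[OF assms(1)])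
  have "\<not> h + n < h'" using req[OF n(2)] assms(4)[of "h + n"] by auto
  moreover have "\<not> h' < h + n"
  proof
    assume "h' < h + n"
    then have "tp (h + (h' - h)) \<in> X" using n(1) assms(2) by (metis less_diff_conv2 add.commute)
    then show False using assms(2,5) by simp
  qed
  ultimately have "h + n = h'" by simp
  then show "sem H p (q, h', tp) c'" using n(2) by simp
qed

lemma walk_left:
  assumes "q \<in> R" "h' \<le> h" "{..h} \<subseteq> H"
    and "\<And>i. h' < i \<Longrightarrow> i \<le> h \<Longrightarrow> tp i \<in> X" "tp h' \<notin> X"
    and req: "\<And>i e. sem H p (q, i, tp) e \<Longrightarrow> tp i \<notin> X"
  shows "sem H (Star (go R X MoveLeft) ;; p) (q, h, tp) c' \<longleftrightarrow> sem H p (q, h', tp) c'"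
proof
  assume "sem H p (q, h', tp) c'"
  moreover have "sem H (Star (go R X MoveLeft)) (q, h, tp) (q, h', tp)"
    unfolding sem_Star_iff go_left_power[OF assms(1)]
    by (rule exI[of _ "h - h'"]) (use assms(2-4) in auto)
  ultimately show "sem H (Star (go R X MoveLeft) ;; p) (q, h, tp) c'" by auto
next
  assume "sem H (Star (go R X MoveLeft) ;; p) (q, h, tp) c'"
  then obtain n where n: "\<forall>i<n. tp (h - i) \<in> X" "sem H p (q, h - n, tp) c'"
    by (auto simp only: sem.simps(3) relcompp_apply sem_Star_iff go_left_power[OF assms(1)])
  have "\<not> h' < h - n" using req[OF n(2)] assms(4)[of "h - n"] by auto
  moreover have "\<not> h - n < h'"
  proof
    assume "h - n < h'"
    then have "h - h' < n" using assms(2) by simp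
    then have "tp (h - (h - h')) \<in> X" using n(1) by blast
    then show False using assms(2,5) by simp
  qed
  ultimately have "h - n = h'" by simp
  then show "sem H p (q, h', tp) c'" using n(2) by simp
qed

lemma sem_Seq_goD: "sem H (go R X d ;; p) (q, h, tp) c' \<Longrightarrow> tp h \<in> X"
  by (auto simp: sem_go)

lemma sem_goD: "sem H (go R X d) (q, h, tp) c' \<Longrightarrow> tp h \<in> X"
  by (auto simp: sem_go)

lemma sem_go_Seq:
  "sem H (go R X d ;; p) (q, h, tp) c' \<longleftrightarrow> q \<in> R \<and> tp h \<in> X \<and> h \<in> H \<and> move_head d h \<in> H \<and>
    sem H p (q, move_head d h, tp) c'"
  by (auto simp: sem_go)

lemma sem_put_Seq:
  "sem H (put R x y ;; p) (q, h, tp) c' \<longleftrightarrow> q \<in> R \<and> tp h = x \<and> h \<in> H \<and> Suc h \<in> H \<and>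
    sem H p (q, Suc h, tp(h := y)) c'"
  by (auto simp: sem_put)

text \<open>Symbol 2 is a free slot, symbol 3 a used one, and symbol 1 separates blocks.  The number of
  used slots modulo the size of the simulated alphabet is the content of the simulated cell.
  Overwriting the content \<open>a\<close> by \<open>b\<close> uses up \<open>b + g - a\<close> further slots.\<close>

fun block :: "nat \<times> nat \<Rightarrow> nat list" where
  "block (c, r) = 1 # replicate c 3 @ replicate r 2"

definition blocks :: "(nat \<times> nat) list \<Rightarrow> nat list" where
  "blocks bs = concat (map block bs)"

lemma blocks_simps [simp]:
  "blocks [] = []" "blocks (b # bs) = block b @ blocks bs" "blocks (bs @ bs') = blocks bs @ blocks bs'"
  by (simp_all add: blocks_def)

lemma length_block [simp]: "length (block b) = Suc (fst b + snd b)"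
  by (cases b) simp

lemma set_block: "set (block b) \<subseteq> {1, 2, 3}"
  by (cases b) auto

lemma set_blocks: "set (blocks bs) \<subseteq> {1, 2, 3}"
  using set_block by (fastforce simp: blocks_def)

lemma tape_blocks_0: "tape (blocks bs) 0 = (if bs = [] then 0 else 1)"
  by (cases bs) (auto simp: tape_def)

lemma tape_block:
  "tape (l @ block (c, r) @ post) (Suc (length l + i)) =
    (if i < c then 3 else if i < c + r then 2 else tape post (i - c - r))"
  by (auto simp: tape_append tape_Cons tape_replicate)

lemma tape_block_start: "tape (l @ block b @ post) (length l) = 1"
  by (cases b) (simp add: tape_def nth_append)

lemma tape_block_use:
  assumes "k \<le> r"
  shows "(\<lambda>i. if Suc (length l + c) \<le> i \<and> i < Suc (length l + c) + k then 3
      else tape (l @ block (c, r) @ post) i) = tape (l @ block (c + k, r - k) @ post)"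
proof
  fix i
  show "(if Suc (length l + c) \<le> i \<and> i < Suc (length l + c) + k then 3
      else tape (l @ block (c, r) @ post) i) = tape (l @ block (c + k, r - k) @ post) i"
  proof (cases "i \<le> length l")
    case True
    then show ?thesis by (auto simp: tape_append tape_Cons)
  next
    case False
    then obtain j where j: "i = Suc (length l + j)" by (metis add_Suc_right less_imp_Suc_add not_le)
    show ?thesis unfolding j tape_block using assms by auto
  qed
qed

section \<open>Overwriting a simulated cell\<close>

text \<open>Tests the content and replaces it in a single pass: used slots are skipped in groups of
  \<open>g\<close>, then \<open>a\<close> more, and the demand for a free slot shows that none was
  left out. The summand \<open>g\<close> makes \<open>b + g - a\<close> positive, so this demand is
  always made, also for \<open>b \<le> a\<close>.\<close>

definition write_prog :: "nat set \<Rightarrow> nat \<Rightarrow> nat \<Rightarrow> nat \<Rightarrow> nat \<Rightarrow> nat \<Rightarrow> prog" where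
  "write_prog R g q a q' b = Act {(q, 1, q', 1, MoveRight)} ;; Star (rep g (put R 3 3)) ;;
     rep a (put R 3 3) ;; rep (b + g - a) (put R 2 3)"

lemma sem_write_prog:
  fixes b :: nat
  assumes "q' \<in> R" "a < g" "tape post 0 \<in> {0, 1}" "{..length (l @ block (c, r) @ post)} \<subseteq> H"
  defines "k \<equiv> b + g - a"
  shows "sem H (write_prog R g q a q' b) (q0, length l, tape (l @ block (c, r) @ post)) c' \<longleftrightarrow>
    q0 = q \<and> c mod g = a \<and> k \<le> r \<and>
    c' = (q', Suc (length l + (c + k)), tape (l @ block (c + k, r - k) @ post))"
proof -
  let ?tp = "tape (l @ block (c, r) @ post)"
  let ?h = "Suc (length l)"
  have pos: "length l \<in> H" "?h \<in> H" using assms(4) by auto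
  have tp: "?tp (?h + i) = (if i < c then 3 else if i < c + r then 2 else tape post (i - c - r))" for i
    using tape_block[of l c r post i] by simp
  have "k > 0" using assms(2) by (simp add: k_def)
  have "sem H (write_prog R g q a q' b) (q0, length l, ?tp) c' \<longleftrightarrow> q0 = q \<and>
    (sem H (Star (rep g (put R 3 3))) OO sem H (rep a (put R 3 3)) OO sem H (rep k (put R 2 3))) (q', ?h, ?tp) c'"
    using pos tape_block_start[of l "(c, r)" post] 
    by (simp add: write_prog_def relcompp_apply act_triple_iff head_of_def k_def fun_upd_idem)
  \<comment> \<open>The two scanning loops merge into one of length \<open>g * j + a\<close>, that
    is, of any length congruent to \<open>a\<close> modulo \<open>g\<close> and at least
    \<open>a\<close>.\<close>
  also have "\<dots> \<longleftrightarrow> q0 = q \<and> (\<exists>j. (sem H (put R 3 3) ^^ (g * j + a) OO sem H (put R 2 3) ^^ k) (q', ?h, ?tp) c')"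
    unfolding relpowp_add
    by (auto simp only: sem_Star_iff relcompp_apply sem_rep relpowp_relpowp)
  also have "\<dots> \<longleftrightarrow> q0 = q \<and> (\<exists>j. (\<forall>i<g * j + a. ?tp (?h + i) = 3) \<and> (\<forall>i<k. ?tp (?h + (g * j + a) + i) = 2) \<and>
      (0 < g * j + a \<longrightarrow> {?h..?h + (g * j + a)} \<subseteq> H) \<and> {?h + (g * j + a)..?h + (g * j + a) + k} \<subseteq> H \<and>
      c' = (q', ?h + (g * j + a) + k, \<lambda>i. if ?h + (g * j + a) \<le> i \<and> i < ?h + (g * j + a) + k then 3 else ?tp i))"
    unfolding put_power_twice[OF assms(1) \<open>k > 0\<close>] ..
  also have "\<dots> \<longleftrightarrow> q0 = q \<and> c mod g = a \<and> k \<le> r \<and>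
    c' = (q', Suc (length l + (c + k)), tape (l @ block (c + k, r - k) @ post))"
  proof (intro iffI; elim conjE exE)
    fix j
    assume 1: "\<forall>i<g * j + a. ?tp (?h + i) = 3" and 2: "\<forall>i<k. ?tp (?h + (g * j + a) + i) = 2"
      and c': "c' = (q', ?h + (g * j + a) + k, \<lambda>i. if ?h + (g * j + a) \<le> i \<and> i < ?h + (g * j + a) + k then 3 else ?tp i)"
      and "q0 = q"
    \<comment> \<open>A scan that is too long would read a 3 behind the used slots, where there is a
      free slot or, for \<open>r = 0\<close>, the start of \<open>post\<close>. One that is too
      short would need a 2 on a used slot.\<close>
    have "\<not> c < g * j + a" using 1[rule_format, of c] assms(3) unfolding tp by (cases "0 < r") auto
    moreover have "?tp (?h + (g * j + a)) = 2" using 2 \<open>k > 0\<close> by fastforce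
    then have "\<not> g * j + a < c" unfolding tp by auto
    ultimately have c: "g * j + a = c" by simp
    then have "c mod g = a" using assms(2) by auto
    moreover have "k \<le> r"
    proof (rule ccontr)
      assume "\<not> k \<le> r"
      then have "?tp (?h + c + r) = 2" using 2 c by auto
      then show False using tp[of "c + r"] assms(3) by (auto simp: add.assoc)
    qed
    ultimately show "q0 = q \<and> c mod g = a \<and> k \<le> r \<and>
        c' = (q', Suc (length l + (c + k)), tape (l @ block (c + k, r - k) @ post))"
      using c' \<open>q0 = q\<close> tape_block_use[OF \<open>k \<le> r\<close>, of l c post] unfolding c by simp
  next
    assume "q0 = q" "c mod g = a" and k: "k \<le> r"
      and c': "c' = (q', Suc (length l + (c + k)), tape (l @ block (c + k, r - k) @ post))"
    then have c: "g * (c div g) + a = c" by auto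
    show "q0 = q \<and> (\<exists>j. (\<forall>i<g * j + a. ?tp (?h + i) = 3) \<and> (\<forall>i<k. ?tp (?h + (g * j + a) + i) = 2) \<and>
      (0 < g * j + a \<longrightarrow> {?h..?h + (g * j + a)} \<subseteq> H) \<and> {?h + (g * j + a)..?h + (g * j + a) + k} \<subseteq> H \<and>
      c' = (q', ?h + (g * j + a) + k, \<lambda>i. if ?h + (g * j + a) \<le> i \<and> i < ?h + (g * j + a) + k then 3 else ?tp i))"
    proof (intro conjI exI[of _ "c div g"])
      show "\<forall>i<k. ?tp (?h + (g * (c div g) + a) + i) = 2"
        unfolding c add.assoc tp using k by auto
      show "{?h + (g * (c div g) + a)..?h + (g * (c div g) + a) + k} \<subseteq> H"
        "0 < g * (c div g) + a \<longrightarrow> {?h..?h + (g * (c div g) + a)} \<subseteq> H"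
        unfolding c using assms(4) k by auto
      show "c' = (q', ?h + (g * (c div g) + a) + k,
        \<lambda>i. if ?h + (g * (c div g) + a) \<le> i \<and> i < ?h + (g * (c div g) + a) + k then 3 else ?tp i)"
        unfolding c c' using tape_block_use[OF k, of l c post] by simp
    qed (use \<open>q0 = q\<close> c tp in auto)
  qed
  finally show ?thesis .
qed

section \<open>Moving between blocks\<close>

text \<open>Starts just behind the last used slot. This cell may already be the separator of the
  next block, so leftward walks first make one unconditional step. After leaving the separator to
  the left, reading 0 means that the block was the first one, and the head returns, as a truncated
  left move requires.\<close>

fun turn_prog :: "nat set \<Rightarrow> move \<Rightarrow> prog" where
  "turn_prog R MoveRight = Star (go R {2, 3} MoveRight) ;; go R {1} Stay"
| "turn_prog R Stay = go R {0, 1, 2, 3} MoveLeft ;; Star (go R {2, 3} MoveLeft) ;; go R {1} Stay"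
| "turn_prog R MoveLeft = go R {0, 1, 2, 3} MoveLeft ;; Star (go R {2, 3} MoveLeft) ;; go R {1} MoveLeft ;;
     Alt (go R {0} MoveRight) (Star (go R {2, 3} MoveLeft) ;; go R {1} Stay)"

text \<open>The leading 3s are the input cells after copying. The blank that ended the input is
  never written and remains as the left boundary of the blocks.\<close>

definition layout :: "nat \<Rightarrow> (nat \<times> nat) list \<Rightarrow> nat list" where
  "layout n bs = replicate n 3 @ 0 # blocks bs"

definition block_pos :: "nat \<Rightarrow> (nat \<times> nat) list \<Rightarrow> nat \<Rightarrow> nat" where
  "block_pos n bs h = Suc (n + length (blocks (take h bs)))"

lemma layout_le_3: "tape (layout n bs) i \<in> {0, 1, 2, 3}"
  using tape_segment[of "[]" i "layout n bs" "[]"] tape_ge[of "layout n bs" i] set_blocks[of bs]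
  by (cases "i < length (layout n bs)") (auto simp: layout_def)

lemma tape_layout_gap: "tape (layout n bs) n = 0"
  by (simp add: layout_def tape_append tape_Cons)

lemma layout_split:
  "layout n (bs1 @ b # bs2) = (replicate n 3 @ 0 # blocks bs1) @ block b @ blocks bs2"
  by (simp add: layout_def)

lemma block_pos_split [simp]: "block_pos n (bs1 @ bs2) (length bs1) = length (replicate n 3 @ 0 # blocks bs1)"
  by (simp add: block_pos_def)

lemma walk_left_to_separator:
  assumes "q \<in> R" "j \<le> c + r" "{..Suc (length l + (c + r))} \<subseteq> H"
    and "tp = tape (l @ block (c, r) @ post)"
    and "\<And>i e. sem H p (q, i, tp) e \<Longrightarrow> tp i \<notin> {2, 3}"
  shows "sem H (Star (go R {2, 3} MoveLeft) ;; p) (q, length l + j, tp) c' \<longleftrightarrow> sem H p (q, length l, tp) c'"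
proof (rule walk_left)
  fix i assume i: "length l < i" "i \<le> length l + j"
  then obtain m where "i = Suc (length l + m)" by (metis add_Suc_right less_imp_Suc_add)
  then show "tp i \<in> {2, 3}" unfolding assms(4) using tape_block[of l c r post m] i assms(2) by auto
qed (use assms tape_block_start[of l "(c, r)" post] in auto)

text \<open>Each walk is forced by the separators. Right of the last block there is a 0 instead of a
  separator, so that leaving the blocks gets stuck.\<close>

lemma sem_turn_prog:
  assumes q: "q \<in> R" and H: "{..length (layout n bs)} \<subseteq> H"
    and bs: "bs = bs1 @ (c, r) # bs2" and c: "0 < c" and h: "h = length bs1"
  shows "sem H (turn_prog R d) (q, Suc (block_pos n bs h + c), tape (layout n bs)) c' \<longleftrightarrow>
    move_head d h < length bs \<and> c' = (q, block_pos n bs (move_head d h), tape (layout n bs))"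
proof -
  let ?l = "replicate n 3 @ 0 # blocks bs1"
  let ?tp = "tape (layout n bs)"
  have L: "block_pos n bs h = length ?l" by (simp add: bs h)
  have tp: "?tp = tape (?l @ block (c, r) @ blocks bs2)" by (simp add: bs layout_split)
  have in_H: "i \<in> H" if "i \<le> Suc (length ?l + (c + r))" for i
    using H that by (auto simp: bs layout_split)
  have start: "?tp (length ?l) = 1" unfolding tp by (rule tape_block_start)
  \<comment> \<open>The part common to \<open>Stay\<close> and \<open>MoveLeft\<close>: back to the
    separator of the current block.\<close>
  have return: "sem H (go R {0, 1, 2, 3} MoveLeft ;; Star (go R {2, 3} MoveLeft) ;; p) (q, Suc (length ?l + c), ?tp) c'
      \<longleftrightarrow> sem H p (q, length ?l, ?tp) c'"
    if "\<And>i e. sem H p (q, i, ?tp) e \<Longrightarrow> ?tp i \<notin> {2, 3}" for p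
  proof -
    have "sem H (go R {0, 1, 2, 3} MoveLeft ;; Star (go R {2, 3} MoveLeft) ;; p) (q, Suc (length ?l + c), ?tp) c'
      \<longleftrightarrow> sem H (Star (go R {2, 3} MoveLeft) ;; p) (q, length ?l + c, ?tp) c'"
      unfolding sem_go_Seq using q in_H layout_le_3 by simp
    also have "\<dots> \<longleftrightarrow> sem H p (q, length ?l, ?tp) c'"
      by (rule walk_left_to_separator[OF q _ _ tp that]) (use in_H in auto)
    finally show ?thesis .
  qed
  have stop: "?tp i \<notin> {2, 3}" if "sem H (go R {1} d) (q, i, ?tp) e" for i d e
    using sem_goD[OF that] by simp
  have stop': "?tp i \<notin> {2, 3}" if "sem H (go R {1} d ;; p) (q, i, ?tp) e" for i d e p
    using sem_Seq_goD[OF that] by simp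
  show ?thesis
  proof (cases d)
    case MoveRight
    have nxt: "?tp (Suc (length ?l + (c + r))) = (if bs2 = [] then 0 else 1)"
      unfolding tp tape_block by (simp add: tape_blocks_0)
    have "sem H (turn_prog R MoveRight) (q, Suc (length ?l + c), ?tp) c' \<longleftrightarrow>
      sem H (go R {1} Stay) (q, Suc (length ?l + (c + r)), ?tp) c'"
      unfolding turn_prog.simps
    proof (rule walk_right[OF q])
      fix i assume i: "Suc (length ?l + c) \<le> i" "i < Suc (length ?l + (c + r))"
      then obtain m where m: "i = Suc (length ?l + m)" by (metis Suc_le_D add_Suc_right le_add1 le_Suc_ex add_Suc add.assoc)
      show "?tp i \<in> {2, 3}" unfolding tp m tape_block using i m by auto
    qed (use in_H nxt stop in auto)
    also have "\<dots> \<longleftrightarrow> bs2 \<noteq> [] \<and> c' = (q, Suc (length ?l + (c + r)), ?tp)"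
      unfolding sem_go nxt using q in_H by auto
    also have "\<dots> \<longleftrightarrow> move_head MoveRight h < length bs \<and> c' = (q, block_pos n bs (move_head MoveRight h), ?tp)"
      by (auto simp: bs h block_pos_def)
    finally show ?thesis using MoveRight L by simp
  next
    case Stay
    have "sem H (turn_prog R Stay) (q, Suc (length ?l + c), ?tp) c' \<longleftrightarrow>
      sem H (go R {1} Stay) (q, length ?l, ?tp) c'"
      unfolding turn_prog.simps by (rule return) (rule stop)
    also have "\<dots> \<longleftrightarrow> c' = (q, length ?l, ?tp)"
      unfolding sem_go using q in_H start by auto
    finally show ?thesis using Stay L by (auto simp: bs h)
  next
    case MoveLeft
    let ?alt = "Alt (go R {0} MoveRight) (Star (go R {2, 3} MoveLeft) ;; go R {1} Stay)"
    have "sem H (turn_prog R MoveLeft) (q, Suc (length ?l + c), ?tp) c' \<longleftrightarrow>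
      sem H (go R {1} MoveLeft ;; ?alt) (q, length ?l, ?tp) c'"
      unfolding turn_prog.simps by (rule return) (rule stop')
    also have "\<dots> \<longleftrightarrow> sem H ?alt (q, length ?l - 1, ?tp) c'"
      unfolding sem_go_Seq using q in_H start by auto
    also have "\<dots> \<longleftrightarrow> c' = (q, block_pos n bs (h - 1), ?tp)"
    proof (cases bs1 rule: rev_cases)
      case Nil
      then have l: "length ?l - 1 = n" by simp
      have "\<not> sem H (Star (go R {2, 3} MoveLeft) ;; go R {1} Stay) (q, n, ?tp) c'"
        by (subst walk_left[where h' = n]) (use q in_H tape_layout_gap stop Nil in \<open>auto simp: sem_go\<close>)
      moreover have "sem H (go R {0} MoveRight) (q, n, ?tp) c' \<longleftrightarrow> c' = (q, Suc n, ?tp)"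
        unfolding sem_go using q in_H tape_layout_gap Nil by auto
      ultimately show ?thesis unfolding l using Nil by (simp add: h block_pos_def)
    next
      case (snoc bs0 b)
      obtain c0 r0 where b: "b = (c0, r0)" by (cases b)
      let ?m = "replicate n 3 @ 0 # blocks bs0"
      have tp0: "?tp = tape (?m @ block (c0, r0) @ blocks ((c, r) # bs2))"
        using layout_split[of n bs0 "(c0, r0)" "(c, r) # bs2"] by (simp add: bs snoc b)
      have l: "length ?l - 1 = length ?m + (c0 + r0)" by (simp add: snoc b)
      have "sem H (Star (go R {2, 3} MoveLeft) ;; go R {1} Stay) (q, length ?m + (c0 + r0), ?tp) c'
        \<longleftrightarrow> sem H (go R {1} Stay) (q, length ?m, ?tp) c'"
        by (rule walk_left_to_separator[OF q _ _ tp0 stop]) (use in_H in \<open>auto simp: snoc b\<close>)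
      also have "\<dots> \<longleftrightarrow> c' = (q, length ?m, ?tp)"
        unfolding sem_go using q in_H tape_block_start[of ?m "(c0, r0)", folded tp0]
        by (subst tp0, subst tape_block_start) (auto simp: snoc)
      finally have 1: "sem H (Star (go R {2, 3} MoveLeft) ;; go R {1} Stay) (q, length ?m + (c0 + r0), ?tp) c'
        \<longleftrightarrow> c' = (q, length ?m, ?tp)" .
      \<comment> \<open>The last cell of a block is never 0, so the two alternatives exclude each
        other.\<close>
      have "?tp (length ?m + (c0 + r0)) \<in> set (block (c0, r0))"
        unfolding tp0 by (rule tape_segment) auto
      then have "\<not> sem H (go R {0} MoveRight) (q, length ?m + (c0 + r0), ?tp) c'"
        using set_block[of "(c0, r0)"] by (auto simp: sem_go)
      with 1 show ?thesis unfolding l sem.simps(4) by (simp add: h snoc bs block_pos_def)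
    qed
    finally show ?thesis using MoveLeft L by (auto simp: bs h)
  qed
qed

section \<open>One simulated transition\<close>

fun step_prog :: "nat set \<Rightarrow> nat \<Rightarrow> nat \<times> nat \<times> nat \<times> nat \<times> move \<Rightarrow> prog" where
  "step_prog R g (q, a, q', b, d) = write_prog R g q a q' b ;; turn_prog R d"

lemma length_layout_update:
  assumes "h < length bs" "k \<le> snd (bs ! h)"
  shows "length (layout n (bs[h := (fst (bs ! h) + k, snd (bs ! h) - k)])) = length (layout n bs)"
proof -
  obtain bs1 b bs2 where "bs = bs1 @ b # bs2" "h = length bs1"
    using assms(1) by (metis id_take_nth_drop length_take less_imp_le_nat min.absorb2)
  then show ?thesis using assms(2) by (auto simp: layout_def)
qed

text \<open>Besides the transition being applicable, exactly two things can fail: the block has too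
  few free slots, or the head would leave the list of blocks.\<close>

lemma sem_step_prog:
  fixes b :: nat
  assumes "q' \<in> R" "a < g" "h < length bs" "{..length (layout n bs)} \<subseteq> H"
  defines "k \<equiv> b + g - a"
  defines "bs' \<equiv> bs[h := (fst (bs ! h) + k, snd (bs ! h) - k)]"
  shows "sem H (step_prog R g (q, a, q', b, d)) (q0, block_pos n bs h, tape (layout n bs)) c' \<longleftrightarrow>
    q0 = q \<and> fst (bs ! h) mod g = a \<and> k \<le> snd (bs ! h) \<and> move_head d h < length bs \<and>
    c' = (q', block_pos n bs' (move_head d h), tape (layout n bs'))"
proof -
  obtain bs1 c r bs2 where bs: "bs = bs1 @ (c, r) # bs2" "h = length bs1"
    using assms(3) by (metis id_take_nth_drop length_take less_imp_le_nat min.absorb2 surj_pair)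
  let ?l = "replicate n 3 @ 0 # blocks bs1"
  have bs': "bs' = bs1 @ (c + k, r - k) # bs2" by (simp add: bs'_def bs)
  have pos: "block_pos n bs h = length ?l" "block_pos n bs' h = length ?l" by (simp_all add: bs bs')
  have len: "length (layout n bs') = length (layout n bs)" if "k \<le> r"
    using that by (simp add: bs bs' layout_def)
  have "sem H (write_prog R g q a q' b) (q0, block_pos n bs h, tape (layout n bs)) e \<longleftrightarrow>
    q0 = q \<and> c mod g = a \<and> k \<le> r \<and> e = (q', Suc (block_pos n bs' h + (c + k)), tape (layout n bs'))" for e
    using assms(4) unfolding pos unfolding bs(1) bs' layout_split k_def
    by (intro sem_write_prog assms(1,2)) (auto simp: tape_blocks_0)
  then have "sem H (step_prog R g (q, a, q', b, d)) (q0, block_pos n bs h, tape (layout n bs)) c' \<longleftrightarrow>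
    q0 = q \<and> c mod g = a \<and> k \<le> r \<and>
    sem H (turn_prog R d) (q', Suc (block_pos n bs' h + (c + k)), tape (layout n bs')) c'"
    by (auto simp only: step_prog.simps sem.simps(3) relcompp_apply)
  also have "\<dots> \<longleftrightarrow> q0 = q \<and> c mod g = a \<and> k \<le> r \<and> move_head d h < length bs' \<and>
      c' = (q', block_pos n bs' (move_head d h), tape (layout n bs'))"
    using sem_turn_prog[OF assms(1) _ bs', of n H h d c'] assms(2,4) len bs(2)
    by (auto simp: k_def)
  finally show ?thesis by (simp add: bs bs')
qed

section \<open>Building the blocks from the input\<close>

text \<open>The last loop guesses the number of free slots; the \<open>a\<close> slots used at once
  give the block the content \<open>a\<close>, if \<open>a < g\<close>.\<close>

definition new_block :: "nat set \<Rightarrow> nat \<Rightarrow> prog" where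
  "new_block R a = put R 0 1 ;; rep a (put R 0 3) ;; Star (put R 0 2)"

lemma put_power_end:
  assumes "q \<in> R"
  shows "(sem H (put R 0 y) ^^ n) (q, length l, tape l) c' \<longleftrightarrow>
    c' = (q, length l + n, tape (l @ replicate n y)) \<and> (0 < n \<longrightarrow> {length l..length l + n} \<subseteq> H)"
proof -
  have "(\<lambda>i. if length l \<le> i \<and> i < length l + n then y else tape l i) = tape (l @ replicate n y)"
    by (auto simp: fun_eq_iff tape_append tape_replicate tape_ge)
  then show ?thesis unfolding put_power[OF assms] by (auto simp: tape_ge)
qed

lemma sem_new_block:
  assumes q: "q \<in> R"
  shows "sem H (new_block R a) (q, length l, tape l) c' \<longleftrightarrow>
    (\<exists>r. c' = (q, length (l @ block (a, r)), tape (l @ block (a, r))) \<and>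
      {length l..length (l @ block (a, r))} \<subseteq> H)"
proof -
  have "sem H (new_block R a) (q, length l, tape l) c' \<longleftrightarrow> length l \<in> H \<and> Suc (length l) \<in> H \<and>
     sem H (rep a (put R 0 3) ;; Star (put R 0 2)) (q, length (l @ [1]), tape (l @ [1])) c'"
    unfolding new_block_def sem_put_Seq using q by (auto simp: tape_upd_end tape_ge)
  also have "\<dots> \<longleftrightarrow> length l \<in> H \<and> Suc (length l) \<in> H \<and> (0 < a \<longrightarrow> {Suc (length l)..Suc (length l) + a} \<subseteq> H) \<and>
     sem H (Star (put R 0 2)) (q, length (l @ [1] @ replicate a 3), tape (l @ [1] @ replicate a 3)) c'"
    unfolding sem.simps(3) relcompp_apply sem_rep put_power_end[OF q] by auto
  also have "\<dots> \<longleftrightarrow> (\<exists>r. length l \<in> H \<and> Suc (length l) \<in> H \<and> (0 < a \<longrightarrow> {Suc (length l)..Suc (length l) + a} \<subseteq> H) \<and>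
     (0 < r \<longrightarrow> {Suc (length l) + a..Suc (length l) + a + r} \<subseteq> H) \<and>
     c' = (q, length (l @ block (a, r)), tape (l @ block (a, r))))"
    unfolding sem_Star_iff put_power_end[OF q] by auto
  also have "\<dots> \<longleftrightarrow> (\<exists>r. c' = (q, length (l @ block (a, r)), tape (l @ block (a, r))) \<and>
      {length l..length (l @ block (a, r))} \<subseteq> H)"
  proof -
    have "length l \<in> H \<and> Suc (length l) \<in> H \<and> (0 < a \<longrightarrow> {Suc (length l)..Suc (length l) + a} \<subseteq> H) \<and>
     (0 < r \<longrightarrow> {Suc (length l) + a..Suc (length l) + a + r} \<subseteq> H) \<longleftrightarrow> {length l..length (l @ block (a, r))} \<subseteq> H" for r
    proof -
      have "{length l..length (l @ block (a, r))} = {length l, Suc (length l)} \<union>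
        ((if 0 < a then {Suc (length l)..Suc (length l) + a} else {}) \<union>
         (if 0 < r then {Suc (length l) + a..Suc (length l) + a + r} else {}))"
        by auto
      then show ?thesis by auto
    qed
    then show ?thesis by metis
  qed
  finally show ?thesis .
qed

lemma sem_new_blockD: "sem H (new_block R a) (q, h, tp) c' \<Longrightarrow> tp h = 0"
  by (auto simp: new_block_def sem_put)

lemma sem_Seq_new_blockD: "sem H (new_block R a ;; p) (q, h, tp) c' \<Longrightarrow> tp h = 0"
  by (auto dest: sem_new_blockD)

text \<open>While the input is copied, its cells that have been dealt with are marked by 3, which also
  serves to find the way back to the first remaining one.\<close>

definition loading :: "nat \<Rightarrow> nat list \<Rightarrow> (nat \<times> nat) list \<Rightarrow> nat list" where
  "loading i xs bs = replicate i 3 @ xs @ 0 # blocks bs"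

lemma loading_Nil: "loading n [] bs = layout n bs"
  by (simp add: loading_def layout_def)

lemma tape_loading_0: "tape (loading 0 xs []) = tape xs"
  by (simp add: loading_def tape_snoc_0)

lemma tape_loading_gap: "tape (loading i xs bs) (i + length xs) = 0"
  by (simp add: loading_def tape_append tape_Cons)

lemma tape_loading_blocks:
  "i + length xs < j \<Longrightarrow> j < length (loading i xs bs) \<Longrightarrow> tape (loading i xs bs) j \<in> {1, 2, 3}"
  using tape_segment[of "replicate i 3 @ xs @ [0]" j "blocks bs" "[]"] set_blocks[of bs]
  by (auto simp: loading_def)

lemma tape_loading_input:
  "set xs \<subseteq> {1, 2} \<Longrightarrow> i \<le> j \<Longrightarrow> j < i + length xs \<Longrightarrow> tape (loading i xs bs) j \<in> {1, 2}"
  using tape_segment[of "replicate i 3" j xs "0 # blocks bs"]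
  by (auto simp: loading_def)

lemma length_loading: "length (loading i xs bs) = Suc (i + length xs + length (blocks bs))"
  by (simp add: loading_def)

text \<open>The symbols 1, 2 and 3 occur with different meanings in the input and in the blocks; the
  blank gap keeps the two regions apart. Left of it, the nearest 3 is the input cell copied
  last.\<close>

definition back_prog :: "nat set \<Rightarrow> prog" where
  "back_prog R = go R {0} MoveLeft ;; Star (go R {1, 2, 3} MoveLeft) ;; go R {0} MoveLeft ;;
     Star (go R {1, 2} MoveLeft) ;; go R {3} MoveRight"

lemma sem_back_prog:
  assumes q: "q \<in> R" and xs: "set xs \<subseteq> {1, 2}" and H: "{..length (loading (Suc i) xs bs)} \<subseteq> H"
  shows "sem H (back_prog R) (q, length (loading (Suc i) xs bs), tape (loading (Suc i) xs bs)) c' \<longleftrightarrow>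
    c' = (q, Suc i, tape (loading (Suc i) xs bs))"
proof -
  let ?L = "loading (Suc i) xs bs"
  let ?gap = "Suc (i + length xs)"
  have in_H: "j \<in> H" if "j \<le> length ?L" for j using H that by auto
  have last3: "tape ?L i = 3" by (simp add: loading_def tape_append tape_Cons tape_replicate)
  have "sem H (back_prog R) (q, length ?L, tape ?L) c' \<longleftrightarrow>
    sem H (Star (go R {1, 2, 3} MoveLeft) ;; go R {0} MoveLeft ;;
     Star (go R {1, 2} MoveLeft) ;; go R {3} MoveRight) (q, length ?L - 1, tape ?L) c'"
    unfolding back_prog_def sem_go_Seq using q in_H by (simp add: tape_ge)
  also have "\<dots> \<longleftrightarrow> sem H (go R {0} MoveLeft ;; Star (go R {1, 2} MoveLeft) ;; go R {3} MoveRight) (q, ?gap, tape ?L) c'"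
  proof (rule walk_left[OF q])
    show "tape ?L j \<in> {1, 2, 3}" if "?gap < j" "j \<le> length ?L - 1" for j
      using tape_loading_blocks[of "Suc i" xs j bs] that by (simp add: length_loading)
    show "tape ?L ?gap \<notin> {1, 2, 3}" using tape_loading_gap[of "Suc i" xs bs] by simp
    show "tape ?L j \<notin> {1, 2, 3}"
      if "sem H (go R {0} MoveLeft ;; Star (go R {1, 2} MoveLeft) ;; go R {3} MoveRight) (q, j, tape ?L) e" for j e
      using sem_Seq_goD[OF that] by simp
  qed (use in_H in \<open>auto simp: length_loading\<close>)
  also have "\<dots> \<longleftrightarrow> sem H (Star (go R {1, 2} MoveLeft) ;; go R {3} MoveRight) (q, i + length xs, tape ?L) c'"
    unfolding sem_go_Seq using q in_H tape_loading_gap[of "Suc i" xs bs] by (simp add: length_loading)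
  also have "\<dots> \<longleftrightarrow> sem H (go R {3} MoveRight) (q, i, tape ?L) c'"
  proof (rule walk_left[OF q])
    show "tape ?L j \<in> {1, 2}" if "i < j" "j \<le> i + length xs" for j
      using tape_loading_input[OF xs, of "Suc i" j bs] that by simp
    show "tape ?L j \<notin> {1, 2}" if "sem H (go R {3} MoveRight) (q, j, tape ?L) e" for j e
      using sem_goD[OF that] by simp
  qed (use in_H last3 in \<open>auto simp: length_loading\<close>)
  also have "\<dots> \<longleftrightarrow> c' = (q, Suc i, tape ?L)"
    unfolding sem_go using q in_H last3 by (auto simp: length_loading)
  finally show ?thesis .
qed

text \<open>The bit being copied is not stored in the register: there is one program for each
  \<open>b\<close>, and the first instruction checks that \<open>b\<close> is read.\<close>

definition load_prog :: "nat set \<Rightarrow> nat \<Rightarrow> prog" where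
  "load_prog R b = put R b 3 ;; Star (go R {1, 2} MoveRight) ;; go R {0} MoveRight ;;
     Star (go R {1, 2, 3} MoveRight) ;; new_block R b ;; back_prog R"

lemma sem_load_prog:
  assumes q: "q \<in> R" and xs: "set xs \<subseteq> {1, 2}" and H: "{..length (loading i (x # xs) bs)} \<subseteq> H"
  shows "sem H (load_prog R b) (q, i, tape (loading i (x # xs) bs)) c' \<longleftrightarrow> x = b \<and>
    sem H (new_block R b ;; back_prog R)
      (q, length (loading (Suc i) xs bs), tape (loading (Suc i) xs bs)) c'"
proof -
  let ?L = "loading (Suc i) xs bs"
  let ?gap = "Suc (i + length xs)"
  have len: "length ?L = length (loading i (x # xs) bs)" by (simp add: length_loading)
  have in_H: "j \<in> H" if "j \<le> length ?L" for j using H that len by auto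
  have "tape (loading i (x # xs) bs) i = x"
    using tape_at[of "replicate i 3" x] by (simp add: loading_def)
  moreover have "(tape (loading i (x # xs) bs))(i := 3) = tape ?L"
    using tape_upd[of "replicate i 3" x "xs @ 0 # blocks bs" 3]
    by (simp add: loading_def replicate_app_Cons_same)
  ultimately have "sem H (load_prog R b) (q, i, tape (loading i (x # xs) bs)) c' \<longleftrightarrow> x = b \<and>
    sem H (Star (go R {1, 2} MoveRight) ;; go R {0} MoveRight ;;
     Star (go R {1, 2, 3} MoveRight) ;; new_block R b ;; back_prog R) (q, Suc i, tape ?L) c'"
    unfolding load_prog_def sem_put_Seq using q in_H by (simp add: length_loading)
  also have "\<dots> \<longleftrightarrow> x = b \<and> sem H (go R {0} MoveRight ;;
     Star (go R {1, 2, 3} MoveRight) ;; new_block R b ;; back_prog R) (q, ?gap, tape ?L) c'"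
  proof (rule arg_cong[where f = "(\<and>) (x = b)"], rule walk_right[OF q])
    show "tape ?L j \<in> {1, 2}" if "Suc i \<le> j" "j < ?gap" for j
      using tape_loading_input[OF xs, of "Suc i" j bs] that by simp
    show "tape ?L ?gap \<notin> {1, 2}" using tape_loading_gap[of "Suc i" xs bs] by simp
    show "tape ?L j \<notin> {1, 2}"
      if "sem H (go R {0} MoveRight ;;
        Star (go R {1, 2, 3} MoveRight) ;; new_block R b ;; back_prog R) (q, j, tape ?L) e" for j e
      using sem_Seq_goD[OF that] by simp
  qed (use in_H in \<open>auto simp: length_loading\<close>)
  also have "\<dots> \<longleftrightarrow> x = b \<and>
     sem H (Star (go R {1, 2, 3} MoveRight) ;; new_block R b ;; back_prog R) (q, Suc ?gap, tape ?L) c'"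
    unfolding sem_go_Seq using q in_H tape_loading_gap[of "Suc i" xs bs] by (simp add: length_loading)
  also have "\<dots> \<longleftrightarrow> x = b \<and> sem H (new_block R b ;; back_prog R) (q, length ?L, tape ?L) c'"
  proof (rule arg_cong[where f = "(\<and>) (x = b)"], rule walk_right[OF q])
    show "tape ?L j \<in> {1, 2, 3}" if "Suc ?gap \<le> j" "j < length ?L" for j
      using tape_loading_blocks[of "Suc i" xs j bs] that by simp
    show "tape ?L j \<notin> {1, 2, 3}" if "sem H (new_block R b ;; back_prog R) (q, j, tape ?L) e" for j e
      using sem_Seq_new_blockD[OF that] by simp
  qed (use in_H in \<open>auto simp: length_loading tape_ge\<close>)
  finally show ?thesis .
qed

lemma loading_append_block: "loading i xs bs @ block b = loading i xs (bs @ [b])"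
  by (simp add: loading_def)

lemma load_prog_complete:
  assumes "q \<in> R" "set xs \<subseteq> {1, 2}" "{..length (loading (Suc i) xs (bs @ [(b, r)]))} \<subseteq> H"
  shows "sem H (load_prog R b) (q, i, tape (loading i (b # xs) bs))
    (q, Suc i, tape (loading (Suc i) xs (bs @ [(b, r)])))"
proof -
  have H: "{..length (loading i (b # xs) bs)} \<subseteq> H"
    using assms(3) by (auto simp: length_loading)
  have "sem H (new_block R b) (q, length (loading (Suc i) xs bs), tape (loading (Suc i) xs bs))
    (q, length (loading (Suc i) xs (bs @ [(b, r)])), tape (loading (Suc i) xs (bs @ [(b, r)])))"
    unfolding sem_new_block[OF assms(1)] loading_append_block
    using assms(3) by (intro exI[of _ r]) auto
  then show ?thesis
    unfolding sem_load_prog[OF assms(1,2) H] sem.simps(3) relcompp_apply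
    using sem_back_prog[OF assms] by blast
qed

lemma load_prog_sound:
  assumes "q \<in> R" "set xs \<subseteq> {1, 2}" "b \<in> {1, 2}"
    and "sem UNIV (load_prog R b) (q, i, tape (loading i xs bs)) c'"
  shows "\<exists>xs' r. xs = b # xs' \<and> c' = (q, Suc i, tape (loading (Suc i) xs' (bs @ [(b, r)])))"
proof (cases xs)
  case Nil
  then show ?thesis
    using assms(3,4) tape_loading_gap[of i "[]" bs] by (auto simp: load_prog_def sem_put)
next
  case (Cons x xs')
  then have xs': "set xs' \<subseteq> {1, 2}" using assms(2) by auto
  from assms(4) have x: "x = b" and
    "sem UNIV (new_block R b ;; back_prog R) (q, length (loading (Suc i) xs' bs), tape (loading (Suc i) xs' bs)) c'"
    unfolding Cons using sem_load_prog[OF assms(1) xs', of i x bs UNIV b c'] by auto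
  then obtain r where
    "sem UNIV (back_prog R) (q, length (loading (Suc i) xs' (bs @ [(b, r)])), tape (loading (Suc i) xs' (bs @ [(b, r)]))) c'"
    unfolding sem.simps(3) relcompp_apply sem_new_block[OF assms(1)] loading_append_block by blast
  then show ?thesis using x Cons sem_back_prog[OF assms(1) xs', of i "bs @ [(b, r)]" UNIV c'] by auto
qed

text \<open>The first test for 0 succeeds only if no input is left to copy. The appended blocks are
  blank cells of the simulated tape, in a guessed number, and the last test ensures that there is at
  least one block.\<close>

definition pad_prog :: "nat set \<Rightarrow> prog" where
  "pad_prog R = go R {0} MoveRight ;; Star (go R {1, 2, 3} MoveRight) ;; Star (new_block R 0) ;;
     go R {0} MoveLeft ;; Star (go R {1, 2, 3} MoveLeft) ;; go R {0} MoveRight ;; go R {1} Stay"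

definition setup_prog :: "nat set \<Rightarrow> prog" where
  "setup_prog R = Star (Alt (load_prog R 1) (load_prog R 2)) ;; pad_prog R"

lemma tape_layout_blocks:
  "n < j \<Longrightarrow> j < length (layout n bs) \<Longrightarrow> tape (layout n bs) j \<in> {1, 2, 3}"
  using tape_loading_blocks[of n "[]" j bs] by (simp add: loading_Nil)

lemma length_layout: "length (layout n bs) = Suc (n + length (blocks bs))"
  by (simp add: layout_def)

lemma layout_append_blocks: "layout n bs @ blocks zs = layout n (bs @ zs)"
  by (simp add: layout_def)

lemma sem_final_prog:
  assumes q: "q \<in> R" and H: "{..length (layout n bs)} \<subseteq> H"
  shows "sem H (go R {0} MoveLeft ;; Star (go R {1, 2, 3} MoveLeft) ;; go R {0} MoveRight ;; go R {1} Stay)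
      (q, length (layout n bs), tape (layout n bs)) c' \<longleftrightarrow>
    bs \<noteq> [] \<and> c' = (q, block_pos n bs 0, tape (layout n bs))"
    (is "sem H (_ ;; ?walk ;; ?p) (q, length ?L, tape ?L) c' \<longleftrightarrow> _")
proof -
  have in_H: "j \<in> H" if "j \<le> length ?L" for j using H that by auto
  have first: "tape ?L (Suc n) = (if bs = [] then 0 else 1)"
    using tape_blocks_0[of bs] by (simp add: layout_def tape_append tape_Cons)
  have "sem H (go R {0} MoveLeft ;; ?walk ;; ?p) (q, length ?L, tape ?L) c' \<longleftrightarrow>
      sem H (?walk ;; ?p) (q, length ?L - 1, tape ?L) c'"
    unfolding sem_go_Seq using q in_H by (simp add: tape_ge)
  also have "\<dots> \<longleftrightarrow> sem H ?p (q, n, tape ?L) c'"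
  proof (rule walk_left[OF q])
    show "tape ?L j \<in> {1, 2, 3}" if "n < j" "j \<le> length ?L - 1" for j
      using tape_layout_blocks[of n j bs] that by (simp add: length_layout)
    show "tape ?L j \<notin> {1, 2, 3}" if "sem H ?p (q, j, tape ?L) e" for j e
      using sem_Seq_goD[OF that] by simp
  qed (use in_H tape_layout_gap in \<open>auto simp: length_layout\<close>)
  also have "\<dots> \<longleftrightarrow> bs \<noteq> [] \<and> c' = (q, block_pos n bs 0, tape ?L)"
    unfolding sem_go_Seq sem_go using q in_H tape_layout_gap first
    by (auto simp: length_layout block_pos_def)
  finally show ?thesis .
qed

text \<open>Provides the premise on the continuation that \<open>walk_right\<close> needs in
  \<open>sem_pad_prog\<close>.\<close>

lemma sem_Star_new_block_SeqD:
  assumes "sem H (Star (new_block R a) ;; go R {0} d ;; p) (q, h, tp) c'"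
  shows "tp h = 0"
proof -
  from assms obtain c1 where "(sem H (new_block R a))\<^sup>*\<^sup>* (q, h, tp) c1" "sem H (go R {0} d ;; p) c1 c'"
    by auto
  then show ?thesis
  proof (cases rule: converse_rtranclpE)
    case base
    then show ?thesis using \<open>sem H (go R {0} d ;; p) c1 c'\<close> sem_Seq_goD[of H R "{0}" d p q h tp c'] by simp
  next
    case step
    then show ?thesis using sem_new_blockD by blast
  qed
qed

lemma sem_pad_prog:
  assumes q: "q \<in> R" and H: "{..length (layout n bs)} \<subseteq> H"
  shows "sem H (pad_prog R) (q, n, tape (layout n bs)) c' \<longleftrightarrow>
    sem H (Star (new_block R 0) ;; go R {0} MoveLeft ;; Star (go R {1, 2, 3} MoveLeft) ;; go R {0} MoveRight ;; go R {1} Stay)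
      (q, length (layout n bs), tape (layout n bs)) c'"
    (is "_ \<longleftrightarrow> sem H ?p (q, length ?L, tape ?L) c'")
proof -
  have in_H: "j \<in> H" if "j \<le> length ?L" for j using H that by auto
  have "sem H (pad_prog R) (q, n, tape ?L) c' \<longleftrightarrow> sem H (Star (go R {1, 2, 3} MoveRight) ;; ?p) (q, Suc n, tape ?L) c'"
    unfolding pad_prog_def sem_go_Seq using q in_H tape_layout_gap by (simp add: length_layout)
  also have "\<dots> \<longleftrightarrow> sem H ?p (q, length ?L, tape ?L) c'"
  proof (rule walk_right[OF q])
    show "tape ?L j \<in> {1, 2, 3}" if "Suc n \<le> j" "j < length ?L" for j
      using tape_layout_blocks[of n j bs] that by simp
    show "tape ?L j \<notin> {1, 2, 3}" if "sem H ?p (q, j, tape ?L) e" for j e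
      using sem_Star_new_block_SeqD[OF that] by simp
  qed (use in_H in \<open>auto simp: length_layout tape_ge\<close>)
  finally show ?thesis .
qed

lemma new_blocks_complete:
  assumes "q \<in> R" "set (map fst zs) \<subseteq> {a}" "{..length (l @ blocks zs)} \<subseteq> H"
  shows "sem H (Star (new_block R a)) (q, length l, tape l) (q, length (l @ blocks zs), tape (l @ blocks zs))"
  using assms(2,3)
proof (induction zs rule: rev_induct)
  case (snoc z zs)
  obtain r where z: "z = (a, r)" using snoc.prems(1) by (cases z) auto
  have "sem H (new_block R a) (q, length (l @ blocks zs), tape (l @ blocks zs))
      (q, length ((l @ blocks zs) @ block (a, r)), tape ((l @ blocks zs) @ block (a, r)))"
    unfolding sem_new_block[OF assms(1)] using snoc.prems(2) z by (intro exI[of _ r]) auto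
  moreover have "{..length (l @ blocks zs)} \<subseteq> H" using snoc.prems(2) by auto
  with snoc have "(sem H (new_block R a))\<^sup>*\<^sup>* (q, length l, tape l) (q, length (l @ blocks zs), tape (l @ blocks zs))"
    by simp
  ultimately show ?case by (simp add: z rtranclp.rtrancl_into_rtrancl)
qed simp

lemma new_blocks_sound:
  assumes "q \<in> R" "sem H (Star (new_block R a)) (q, length l, tape l) c'"
  shows "\<exists>zs. set (map fst zs) \<subseteq> {a} \<and> c' = (q, length (l @ blocks zs), tape (l @ blocks zs))"
proof -
  from assms(2) have "(sem H (new_block R a))\<^sup>*\<^sup>* (q, length l, tape l) c'" by simp
  then show ?thesis
  proof (induction rule: rtranclp_induct)
    case base
    show ?case by (rule exI[of _ "[]"]) simp
  next
    case (step c1 c2)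
    then obtain zs r where "set (map fst zs) \<subseteq> {a}"
      "c2 = (q, length ((l @ blocks zs) @ block (a, r)), tape ((l @ blocks zs) @ block (a, r)))"
      using sem_new_block[OF assms(1)] by blast
    then show ?case by (intro exI[of _ "zs @ [(a, r)]"]) simp
  qed
qed

lemma load_progs_complete:
  assumes q: "q \<in> R" and "set (map fst bs @ ys) \<subseteq> {1, 2}" "{..length (loading (length bs) ys bs)} \<subseteq> H"
  shows "sem H (Star (Alt (load_prog R 1) (load_prog R 2))) (q, 0, tape (loading 0 (map fst bs @ ys) []))
    (q, length bs, tape (loading (length bs) ys bs))"
  using assms(2,3)
proof (induction bs arbitrary: ys rule: rev_induct)
  case (snoc z bs)
  obtain b r where z: "z = (b, r)" by (cases z)
  have sub: "set (map fst bs @ b # ys) \<subseteq> {1, 2}" "set ys \<subseteq> {1, 2}" "b \<in> {1, 2}" using snoc.prems(1) z by auto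
  have "sem H (load_prog R b) (q, length bs, tape (loading (length bs) (b # ys) bs))
    (q, Suc (length bs), tape (loading (Suc (length bs)) ys (bs @ [(b, r)])))"
    by (rule load_prog_complete[OF q sub(2)]) (use snoc.prems(2) z in simp)
  moreover have "{..length (loading (length bs) (b # ys) bs)} \<subseteq> H"
    using snoc.prems(2) by (auto simp: length_loading)
  from snoc.IH[OF sub(1) this]
  have "(sem H (Alt (load_prog R 1) (load_prog R 2)))\<^sup>*\<^sup>* (q, 0, tape (loading 0 (map fst bs @ b # ys) []))
    (q, length bs, tape (loading (length bs) (b # ys) bs))" by simp
  ultimately show ?case using sub(3) unfolding z
    by (auto intro: rtranclp.rtrancl_into_rtrancl)
qed simp

lemma load_progs_sound:
  assumes q: "q \<in> R" and "set xs \<subseteq> {1, 2}"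
    and "sem UNIV (Star (Alt (load_prog R 1) (load_prog R 2))) (q, 0, tape (loading 0 xs [])) c'"
  shows "\<exists>bs ys. xs = map fst bs @ ys \<and> c' = (q, length bs, tape (loading (length bs) ys bs))"
proof -
  from assms(3) have "(sem UNIV (Alt (load_prog R 1) (load_prog R 2)))\<^sup>*\<^sup>* (q, 0, tape (loading 0 xs [])) c'" by simp
  then show ?thesis
  proof (induction rule: rtranclp_induct)
    case base
    show ?case by (intro exI[of _ "[]"] exI[of _ xs]) simp
  next
    case (step c1 c2)
    then obtain bs ys where IH: "xs = map fst bs @ ys" "c1 = (q, length bs, tape (loading (length bs) ys bs))"
      by blast
    from step.hyps(2) obtain b where b: "b \<in> {1, 2}" "sem UNIV (load_prog R b) c1 c2" by auto
    have "set ys \<subseteq> {1, 2}" using assms(2) IH(1) by auto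
    from load_prog_sound[OF q this b(1) b(2)[unfolded IH(2)]]
    obtain ys' r where "ys = b # ys'" "c2 = (q, Suc (length bs), tape (loading (Suc (length bs)) ys' (bs @ [(b, r)])))"
      by blast
    then show ?case using IH(1) by (intro exI[of _ "bs @ [(b, r)]"] exI[of _ ys']) simp
  qed
qed

text \<open>Every list of blocks with the right contents can be produced, whatever its numbers of
  free slots; the simulation later picks the list that suits the length of the run.\<close>

lemma setup_prog_complete:
  assumes q: "q \<in> R" and xs: "set xs \<subseteq> {1, 2}" and bs: "bs \<noteq> []" "map fst bs = xs @ replicate m 0"
    and H: "{..length (layout (length xs) bs)} \<subseteq> H"
  shows "sem H (setup_prog R) (q, 0, tape xs) (q, block_pos (length xs) bs 0, tape (layout (length xs) bs))"
proof -
  obtain bs1 zs where zs: "bs = bs1 @ zs" "xs = map fst bs1" "replicate m 0 = map fst zs"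
    using bs(2) by (metis append_eq_map_conv)
  have "set (map fst zs) \<subseteq> {0}" unfolding zs(3)[symmetric] by auto
  have n: "length xs = length bs1" by (simp add: zs)
  have H1: "{..length (layout (length xs) bs1)} \<subseteq> H" using H by (auto simp: zs length_layout)
  have "sem H (Star (Alt (load_prog R 1) (load_prog R 2))) (q, 0, tape xs) (q, length xs, tape (layout (length xs) bs1))"
    using load_progs_complete[OF q, of bs1 "[]" H] xs H1 zs(2) n by (simp add: loading_Nil tape_loading_0)
  moreover have "sem H (pad_prog R) (q, length xs, tape (layout (length xs) bs1))
      (q, block_pos (length xs) bs 0, tape (layout (length xs) bs))"
  proof -
    have "sem H (Star (new_block R 0)) (q, length (layout (length xs) bs1), tape (layout (length xs) bs1))
      (q, length (layout (length xs) bs), tape (layout (length xs) bs))"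
      using new_blocks_complete[OF q \<open>set (map fst zs) \<subseteq> {0}\<close>, of "layout (length xs) bs1" H] H
      by (simp only: layout_append_blocks zs(1))
    then show ?thesis
      unfolding sem_pad_prog[OF q H1] using sem_final_prog[OF q H] bs(1)
      by (subst sem.simps(3)) (simp only: relcompp_apply, blast)
  qed
  ultimately show ?thesis unfolding setup_prog_def sem.simps(3) by blast
qed

lemma setup_prog_sound:
  assumes q: "q \<in> R" and xs: "set xs \<subseteq> {1, 2}" and "sem UNIV (setup_prog R) (q, 0, tape xs) c'"
  shows "\<exists>bs. bs \<noteq> [] \<and> (\<forall>j<length bs. fst (bs ! j) = tape xs j) \<and>
    c' = (q, block_pos (length xs) bs 0, tape (layout (length xs) bs))"
proof -
  from assms(3) obtain c1 where
    c1: "sem UNIV (Star (Alt (load_prog R 1) (load_prog R 2))) (q, 0, tape (loading 0 xs [])) c1" "sem UNIV (pad_prog R) c1 c'"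
    unfolding setup_prog_def sem.simps(3) relcompp_apply tape_loading_0 by blast
  from load_progs_sound[OF q xs c1(1)]
  obtain bs ys where bs: "xs = map fst bs @ ys" "c1 = (q, length bs, tape (loading (length bs) ys bs))" by blast
  \<comment> \<open>Padding begins on a blank, hence copying cannot have been broken off
    early.\<close>
  have "tape (loading (length bs) ys bs) (length bs) = 0"
    using sem_Seq_goD[OF c1(2)[unfolded bs(2) pad_prog_def]] by simp
  then have ys: "ys = []"
    using tape_loading_input[of ys "length bs" "length bs" bs] xs bs(1) by fastforce
  then have n: "length bs = length xs" by (simp add: bs)
  have "sem UNIV (pad_prog R) (q, length xs, tape (layout (length xs) bs)) c'"
    using c1(2) unfolding bs(2) ys loading_Nil n .
  then obtain c2 where c2: "sem UNIV (Star (new_block R 0)) (q, length (layout (length xs) bs), tape (layout (length xs) bs)) c2"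
    "sem UNIV (go R {0} MoveLeft ;; Star (go R {1, 2, 3} MoveLeft) ;; go R {0} MoveRight ;; go R {1} Stay) c2 c'"
    unfolding sem_pad_prog[OF q subset_UNIV] by (subst (asm) sem.simps(3)) blast
  obtain zs where zs: "set (map fst zs) \<subseteq> {0}"
    "c2 = (q, length (layout (length xs) (bs @ zs)), tape (layout (length xs) (bs @ zs)))"
    using new_blocks_sound[OF q c2(1)] unfolding layout_append_blocks by blast
  have "fst ((bs @ zs) ! j) = tape xs j" if "j < length (bs @ zs)" for j
  proof (cases "j < length bs")
    case True
    then show ?thesis using bs(1) ys by (simp add: nth_append tape_def)
  next
    case False
    then have "zs ! (j - length bs) \<in> set zs" using that by simp
    then show ?thesis using False zs(1) n by (auto simp: nth_append tape_def)
  qed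
  then show ?thesis
    using c2(2) unfolding zs(2) sem_final_prog[OF q subset_UNIV] by blast
qed

section \<open>All instructions respect the marking order\<close>

lemma acts_rep: "acts (rep n p) \<subseteq> acts p"
  by (induction n) auto

lemma acts_go: "X \<subseteq> {..<4} \<Longrightarrow> acts (go R X d) \<subseteq> pair_acts R"
  by (auto simp: go_def pair_acts_def)

lemma acts_put: "x < 4 \<Longrightarrow> y < 4 \<Longrightarrow> x div 2 \<le> y div 2 \<Longrightarrow> x mod 2 \<le> y mod 2 \<Longrightarrow> acts (put R x y) \<subseteq> pair_acts R"
  by (auto simp: put_def pair_acts_def)

lemma acts_setup_prog: "acts (setup_prog R) \<subseteq> pair_acts R"
proof -
  have nb: "acts (new_block R a) \<subseteq> pair_acts R" for a
    using acts_rep[of a "put R 0 3"] acts_put[of 0 3 R] acts_put[of 0 1 R] acts_put[of 0 2 R]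
    by (auto simp: new_block_def)
  have ld: "acts (load_prog R b) \<subseteq> pair_acts R" if "b = 1 \<or> b = 2" for b
  proof -
    have "acts (put R b 3) \<subseteq> pair_acts R" by (rule acts_put) (use that in auto)
    with nb[of b] show ?thesis by (simp add: load_prog_def back_prog_def acts_go)
  qed
  show ?thesis using ld[of 1] ld[of 2] nb[of 0] by (simp add: setup_prog_def pad_prog_def acts_go)
qed

lemma acts_step_prog:
  assumes "q \<in> R" "q' \<in> R"
  shows "acts (step_prog R g (q, a, q', b, d)) \<subseteq> pair_acts R"
proof -
  have "acts (write_prog R g q a q' b) \<subseteq> pair_acts R"
    using assms acts_rep[of a "put R 3 3"] acts_rep[of g "put R 3 3"] acts_put[of 3 3 R]
      acts_rep[of "b + g - a" "put R 2 3"] acts_put[of 2 3 R]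
    by (auto simp: write_prog_def pair_acts_def)
  moreover have "acts (turn_prog R d) \<subseteq> pair_acts R"
    by (cases d) (simp_all add: acts_go)
  ultimately show ?thesis by simp
qed

text \<open>Cells beyond the last block need not be represented, since a program whose head would leave the
  blocks gets stuck.\<close>

definition represents :: "nat \<Rightarrow> nat \<Rightarrow> (nat \<times> nat) list \<Rightarrow> config \<Rightarrow> config \<Rightarrow> bool" where
  "represents n g bs c e \<longleftrightarrow> head_of c < length bs \<and> (\<forall>j<length bs. fst (bs ! j) mod g = snd (snd c) j) \<and>
     e = (state_of c, block_pos n bs (head_of c), tape (layout n bs))"

lemma mod_overwrite:
  fixes c g a b :: nat
  assumes "c mod g = a" "a < g" "b < g"
  shows "(c + (b + g - a)) mod g = b"
proof -
  have "c + (b + g - a) = b + g * Suc (c div g)"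
    using assms mult_div_mod_eq[of g c] by simp
  then show ?thesis using assms(3) by (simp only: mod_mult_self2 mod_less)
qed

lemma step_prog_sound:
  assumes M: "wf_ntm M" and \<tau>: "\<tau> \<in> trans M" and rep: "represents n (num_syms M) bs c e"
    and e': "sem UNIV (step_prog (states M) (num_syms M) \<tau>) e e'"
  shows "\<exists>c' bs'. step M c c' \<and> represents n (num_syms M) bs' c' e'"
proof -
  let ?g = "num_syms M"
  obtain q a q' b d where \<tau>': "\<tau> = (q, a, q', b, d)" by (metis prod_cases5)
  obtain q0 h tp where c: "c = (q0, h, tp)" by (metis prod_cases3)
  have wf: "q' \<in> states M" "a < ?g" "b < ?g" using M \<tau> by (auto simp: \<tau>' wf_ntm_def)
  have h: "h < length bs" and tp: "\<forall>j<length bs. fst (bs ! j) mod ?g = tp j"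
    and e: "e = (q0, block_pos n bs h, tape (layout n bs))"
    using rep by (auto simp: represents_def c head_of_def state_of_def)
  define k where "k = b + ?g - a"
  define bs' where "bs' = bs[h := (fst (bs ! h) + k, snd (bs ! h) - k)]"
  have *: "q0 = q" "fst (bs ! h) mod ?g = a" "k \<le> snd (bs ! h)" "move_head d h < length bs"
    "e' = (q', block_pos n bs' (move_head d h), tape (layout n bs'))"
    using e' unfolding e \<tau>' sem_step_prog[OF wf(1,2) h subset_UNIV] k_def bs'_def by auto
  have "step M c (q', move_head d h, tp(h := b))"
  proof -
    have "tp h = a" using tp h *(2) by simp
    then show ?thesis using \<tau> unfolding c step_triple_iff \<tau>' *(1) by blast
  qed
  moreover have "represents n ?g bs' (q', move_head d h, tp(h := b)) e'"
    using * tp mod_overwrite[OF *(2) wf(2,3)]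
    by (auto simp: represents_def head_of_def state_of_def bs'_def k_def nth_list_update)
  ultimately show ?thesis by blast
qed

text \<open>Every block is required to have room for all remaining steps, as if they all wrote to
  it; one step then costs at most \<open>2 * num_syms M\<close> slots in one block, and the length
  of the layout does not change.\<close>

lemma step_prog_complete:
  assumes M: "wf_ntm M" and st: "step M c c'" and rep: "represents n (num_syms M) bs c e"
    and head: "head_of c' < length bs" and free: "\<forall>j<length bs. 2 * num_syms M * Suc m \<le> snd (bs ! j)"
    and H: "{..length (layout n bs)} \<subseteq> H"
  shows "\<exists>\<tau>\<in>trans M. \<exists>bs' e'. sem H (step_prog (states M) (num_syms M) \<tau>) e e' \<and>
    represents n (num_syms M) bs' c' e' \<and> length bs' = length bs \<and> length (layout n bs') = length (layout n bs) \<and>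
    (\<forall>j<length bs'. 2 * num_syms M * m \<le> snd (bs' ! j))"
proof -
  let ?g = "num_syms M"
  obtain q h tp where c: "c = (q, h, tp)" by (metis prod_cases3)
  obtain q' b d where \<tau>: "(q, tp h, q', b, d) \<in> trans M" and c': "c' = (q', move_head d h, tp(h := b))"
    using st unfolding c step_triple_iff by blast
  have wf: "q' \<in> states M" "tp h < ?g" "b < ?g" using M \<tau> by (auto simp: wf_ntm_def)
  have h: "h < length bs" and tp: "\<forall>j<length bs. fst (bs ! j) mod ?g = tp j"
    and e: "e = (q, block_pos n bs h, tape (layout n bs))"
    using rep by (auto simp: represents_def c head_of_def state_of_def)
  define k where "k = b + ?g - tp h"
  define bs' where "bs' = bs[h := (fst (bs ! h) + k, snd (bs ! h) - k)]"
  \<comment> \<open>Since \<open>b\<close> is below the number of symbols, \<open>b + g - a\<close>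
    is below \<open>2 * g\<close>; the constant in the invariant comes from here.\<close>
  have k2: "k \<le> 2 * ?g" using wf by (simp add: k_def)
  moreover have "2 * ?g * Suc m \<le> snd (bs ! h)" using free h by blast
  ultimately have k: "k \<le> snd (bs ! h)" "2 * ?g * m \<le> snd (bs ! h) - k" by simp_all
  let ?e = "(q', block_pos n bs' (move_head d h), tape (layout n bs'))"
  have hd: "move_head d h < length bs" using head by (simp add: c' head_of_def)
  have mod: "fst (bs ! h) mod ?g = tp h" using tp h by blast
  have "sem H (step_prog (states M) ?g (q, tp h, q', b, d)) e ?e"
    unfolding e sem_step_prog[OF wf(1,2) h H] using hd k(1) mod by (simp add: k_def bs'_def)
  moreover have "represents n ?g bs' c' ?e"
    using hd tp mod_overwrite[OF mod wf(2,3)]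
    by (auto simp: represents_def head_of_def state_of_def bs'_def k_def nth_list_update c')
  moreover have "length bs' = length bs" by (simp add: bs'_def)
  moreover have "length (layout n bs') = length (layout n bs)"
    unfolding bs'_def by (rule length_layout_update[OF h k(1)])
  moreover have "\<forall>j<length bs'. 2 * ?g * m \<le> snd (bs' ! j)"
  proof (intro allI impI)
    fix j assume j: "j < length bs'"
    have "2 * ?g * m \<le> 2 * ?g * Suc m" by simp
    also have "\<dots> \<le> snd (bs ! j)" using free j by (simp only: bs'_def length_list_update)
    finally show "2 * ?g * m \<le> snd (bs' ! j)"
      using k(2) h by (cases "j = h") (simp_all add: bs'_def)
  qed
  ultimately show ?thesis using \<tau> by blast
qed

section \<open>The complete simulation and its space bound\<close>

lemma relpowp_head: "(step M ^^ i) c c' \<Longrightarrow> head_of c' \<le> head_of c + i"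
proof (induction i arbitrary: c')
  case (Suc i)
  then obtain c1 where "(step M ^^ i) c c1" "step M c1 c'" by auto
  with Suc.IH head_of_step_le show ?case by fastforce
qed simp

lemma set_ordinary_input: "set (ordinary_input w) \<subseteq> {1, 2}"
  by (auto simp: ordinary_input_def)

lemma length_blocks_uniform:
  "\<forall>b\<in>set bs. fst b \<le> 2 \<and> snd b = K \<Longrightarrow> length (blocks bs) \<le> length bs * (3 + K)"
  by (induction bs) (auto simp: blocks_def)

text \<open>The machine runs the setup and then arbitrarily many transition programs, with the state
  of \<open>M\<close> as register. Every guess yields a representation of the initial configuration,
  which gives soundness; for a run of length \<open>m\<close> the guesses are made generously
  enough.\<close>

theorem simulate_ordinary:
  assumes M: "ordinary_ntm M"
  obtains M' where "write_once_ntm M'"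
    "\<And>w cs. accepting_run M' (write_once_input w) cs \<Longrightarrow> \<exists>n. accepts_in M (ordinary_input w) n"
    "\<And>w m. accepts_in M (ordinary_input w) m \<Longrightarrow> \<exists>cs. accepting_run M' (write_once_input w) cs \<and>
      run_space cs \<le> 2 * (length w + 2 + (length w + m + 1) * (3 + 2 * num_syms M * m))"
proof -
  let ?g = "num_syms M" and ?R = "states M"
  have wf: "wf_ntm M" and g: "3 \<le> ?g" using M by (auto simp: ordinary_ntm_def)
  then have R: "finite ?R" "start M \<in> ?R" "accepting M \<subseteq> ?R"
    and tr: "trans M \<subseteq> ?R \<times> {..<?g} \<times> ?R \<times> {..<?g} \<times> UNIV" by (auto simp: wf_ntm_def)
  have "finite (trans M)" using R(1) finite_UNIV_move finite_subset[OF tr] by simp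
  from finite_choice_prog[OF this, of "step_prog ?R ?g"]
  obtain p where p: "acts p \<subseteq> (\<Union>\<tau>\<in>trans M. acts (step_prog ?R ?g \<tau>))"
    "\<And>H c c'. sem H p c c' \<longleftrightarrow> (\<exists>\<tau>\<in>trans M. sem H (step_prog ?R ?g \<tau>) c c')" by blast
  define P where "P = setup_prog ?R ;; Star p"
  have step_acts: "acts (step_prog ?R ?g \<tau>) \<subseteq> pair_acts ?R" if "\<tau> \<in> trans M" for \<tau>
  proof -
    obtain q a q' b d where "\<tau> = (q, a, q', b, d)" by (metis prod_cases5)
    then show ?thesis using tr that acts_step_prog by blast
  qed
  then have "acts P \<subseteq> pair_acts ?R"
  proof -
    have "acts p \<subseteq> pair_acts ?R"
      by (rule order_trans[OF p(1)], rule UN_least, rule step_acts)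
    then show ?thesis using acts_setup_prog by (simp add: P_def)
  qed
  from write_once_of_pair_prog[OF R this]
  obtain M' where M': "write_once_ntm M'"
    "\<And>w cs. accepting_run M' (write_once_input w) cs \<Longrightarrow>
      \<exists>c. sem UNIV P (start M, 0, tape (ordinary_input w)) c \<and> state_of c \<in> accepting M"
    "\<And>w S c. sem {..<S} P (start M, 0, tape (ordinary_input w)) c \<Longrightarrow> state_of c \<in> accepting M \<Longrightarrow> 0 < S \<Longrightarrow>
      \<exists>cs. accepting_run M' (write_once_input w) cs \<and> run_space cs \<le> 2 * S"
    by blast
  show thesis
  proof (rule that[OF M'(1)])
    fix w cs
    let ?xs = "ordinary_input w"
    assume "accepting_run M' (write_once_input w) cs"
    from M'(2)[OF this] obtain e0 e where
      e0: "sem UNIV (setup_prog ?R) (start M, 0, tape ?xs) e0" and e: "(sem UNIV p)\<^sup>*\<^sup>* e0 e" "state_of e \<in> accepting M"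
      by (auto simp: P_def)
    have "\<exists>bs. represents (length ?xs) ?g bs (init_config M ?xs) e0"
    proof -
      from setup_prog_sound[OF R(2) set_ordinary_input e0]
      obtain bs where bs: "bs \<noteq> []" "\<forall>j<length bs. fst (bs ! j) = tape ?xs j"
        "e0 = (start M, block_pos (length ?xs) bs 0, tape (layout (length ?xs) bs))" by blast
      have "tape ?xs j mod ?g = tape ?xs j" for j
        using tape_ordinary_input_less[of w j] g by simp
      then show ?thesis using bs
        by (intro exI[of _ bs]) (auto simp: represents_def init_config_tape head_of_def state_of_def)
    qed
    with e(1) have "\<exists>c bs. (step M)\<^sup>*\<^sup>* (init_config M ?xs) c \<and> represents (length ?xs) ?g bs c e"
    proof (induction rule: rtranclp_induct)
      case base
      then show ?case by blast
    next
      case (step e1 e2)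
      then obtain c bs where "(step M)\<^sup>*\<^sup>* (init_config M ?xs) c" "represents (length ?xs) ?g bs c e1" by blast
      moreover obtain \<tau> where "\<tau> \<in> trans M" "sem UNIV (step_prog ?R ?g \<tau>) e1 e2"
        using step.hyps(2) p(2) by blast
      ultimately show ?case using step_prog_sound[OF wf] by (meson rtranclp.rtrancl_into_rtrancl)
    qed
    then obtain c bs where c: "(step M)\<^sup>*\<^sup>* (init_config M ?xs) c" "represents (length ?xs) ?g bs c e" by blast
    then have "state_of c = state_of e" by (auto simp: represents_def state_of_def)
    then show "\<exists>n. accepts_in M ?xs n"
      using c(1) e(2) unfolding accepts_in_def rtranclp_power by metis
  next
    fix w m
    let ?xs = "ordinary_input w"
    let ?n = "length w"
    assume "accepts_in M ?xs m"
    then obtain c where c: "(step M ^^ m) (init_config M ?xs) c" "state_of c \<in> accepting M"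
      by (auto simp: accepts_in_def)
    then obtain f where f: "f 0 = init_config M ?xs" "f m = c" "\<forall>i<m. step M (f i) (f (Suc i))"
      unfolding relpowp_fun_conv by blast
    \<comment> \<open>In \<open>m\<close> steps the head reaches at most cell \<open>m\<close>, and
      all \<open>m\<close> writes may hit the same cell; hence \<open>Suc m\<close> blocks beyond
      the input and \<open>2 * g * m\<close> free slots in each block.\<close>
    define bs where "bs = map (\<lambda>a. (a, 2 * ?g * m)) (?xs @ replicate (Suc m) 0)"
    \<comment> \<open>A block has a separator, at most 2 used slots at the beginning and its free
      slots. The summand 2 counts the gap and the blank behind the last block, which the head
      visits.\<close>
    define S where "S = ?n + 2 + (?n + m + 1) * (3 + 2 * ?g * m)"
    have len: "length bs = ?n + m + 1" by (simp add: bs_def)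
    have "length (blocks bs) \<le> length bs * (3 + 2 * ?g * m)"
      by (rule length_blocks_uniform) (use set_ordinary_input in \<open>fastforce simp: bs_def\<close>)
    then have lay: "length (layout ?n bs) < S" by (simp add: length_layout S_def len)
    have initial: "sem {..<S} (setup_prog ?R) (start M, 0, tape ?xs)
      (start M, block_pos (length ?xs) bs 0, tape (layout (length ?xs) bs))"
    proof (rule setup_prog_complete[OF R(2) set_ordinary_input])
      show "map fst bs = ?xs @ replicate (Suc m) 0" by (simp add: bs_def comp_def)
    qed (use lay len in auto)
    have "\<exists>bs' e. (sem {..<S} p)\<^sup>*\<^sup>* (start M, block_pos ?n bs 0, tape (layout ?n bs)) e \<and>
        represents ?n ?g bs' (f i) e \<and> length bs' = length bs \<and> length (layout ?n bs') = length (layout ?n bs) \<and>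
        (\<forall>j<length bs'. 2 * ?g * (m - i) \<le> snd (bs' ! j))" if "i \<le> m" for i
      using that
    proof (induction i)
      case 0
      have "fst (bs ! j) mod ?g = tape ?xs j" if "j < length bs" for j
      proof -
        have "fst (bs ! j) = (?xs @ replicate (Suc m) 0) ! j"
          using that unfolding bs_def by (simp only: nth_map length_map fst_conv)
        also have "\<dots> = tape ?xs j" using that len by (auto simp: tape_def nth_append nth_Cons')
        finally show ?thesis using tape_ordinary_input_less[of w j] g by simp
      qed
      then have "represents ?n ?g bs (f 0) (start M, block_pos ?n bs 0, tape (layout ?n bs))"
        unfolding f(1) by (simp add: represents_def init_config_tape head_of_def state_of_def len)
      moreover have "\<forall>b\<in>set bs. snd b = 2 * ?g * m" by (auto simp: bs_def)
      then have "\<forall>j<length bs. 2 * ?g * m \<le> snd (bs ! j)" by simp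
      ultimately show ?case by auto
    next
      case (Suc i)
      then obtain bs' e where IH: "(sem {..<S} p)\<^sup>*\<^sup>* (start M, block_pos ?n bs 0, tape (layout ?n bs)) e"
        "represents ?n ?g bs' (f i) e" "length bs' = length bs" "length (layout ?n bs') = length (layout ?n bs)"
        "\<forall>j<length bs'. 2 * ?g * (m - i) \<le> snd (bs' ! j)" by auto
      have st: "step M (f i) (f (Suc i))" using f(3) Suc.prems by simp
      \<comment> \<open>After at most \<open>m\<close> steps the head is at most at
        \<open>m\<close>, so the program never gets stuck at the right end of the blocks.\<close>
      have "(step M ^^ Suc i) (init_config M ?xs) (f (Suc i))"
        unfolding relpowp_fun_conv using f(1,3) Suc.prems by (intro exI[of _ f]) auto
      from relpowp_head[OF this] have "head_of (f (Suc i)) < length bs'"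
        using Suc.prems IH(3) len by (simp add: init_config_tape head_of_def)
      moreover have "m - i = Suc (m - Suc i)" using Suc.prems by simp
      with IH(5) have "\<forall>j<length bs'. 2 * ?g * Suc (m - Suc i) \<le> snd (bs' ! j)" by simp
      moreover have "{..length (layout ?n bs')} \<subseteq> {..<S}" using lay IH(4) by auto
      ultimately obtain \<tau> bs'' e' where "\<tau> \<in> trans M" "sem {..<S} (step_prog ?R ?g \<tau>) e e'"
        "represents ?n ?g bs'' (f (Suc i)) e'" "length bs'' = length bs'"
        "length (layout ?n bs'') = length (layout ?n bs')"
        "\<forall>j<length bs''. 2 * ?g * (m - Suc i) \<le> snd (bs'' ! j)"
        using step_prog_complete[OF wf st IH(2)] by blast
      moreover from this have "sem {..<S} p e e'" using p(2) by blast
      with IH(1) have "(sem {..<S} p)\<^sup>*\<^sup>* (start M, block_pos ?n bs 0, tape (layout ?n bs)) e'"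
        by (rule rtranclp.rtrancl_into_rtrancl)
      ultimately show ?case using IH(3,4) by (intro exI[of _ bs''] exI[of _ e']) simp
    qed
    from this[of m] obtain bs' e where e: "(sem {..<S} p)\<^sup>*\<^sup>* (start M, block_pos ?n bs 0, tape (layout ?n bs)) e"
      "represents ?n ?g bs' (f m) e" by auto
    have acc: "state_of e \<in> accepting M" using e(2) c(2) f(2) by (auto simp: represents_def state_of_def)
    have run: "sem {..<S} P (start M, 0, tape ?xs) e"
      unfolding P_def sem.simps using initial e(1) by (auto intro: relcomppI)
    have "0 < S" by (simp add: S_def)
    from M'(3)[OF run acc this] show "\<exists>cs. accepting_run M' (write_once_input w) cs \<and>
        run_space cs \<le> 2 * (?n + 2 + (?n + m + 1) * (3 + 2 * ?g * m))"
      unfolding S_def .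
  qed
qed

lemma NEXPTIME_subset_NEXPWOSPACE: "k_NEXPTIME k \<subseteq> k_NEXPWOSPACE k"
proof
  fix L assume "L \<in> k_NEXPTIME k"
  then obtain M t where M: "ordinary_ntm M"
    and L: "L = {w. \<exists>cs. accepting_run M (ordinary_input w) cs}"
    and time: "\<And>w. w \<in> L \<Longrightarrow> 2 \<le> length w \<Longrightarrow> \<exists>cs. accepting_run M (ordinary_input w) cs \<and>
                    run_time cs \<le> iter_exp k (length w ^ t)"
    unfolding k_NEXPTIME_def by blast
  let ?g = "num_syms M"
  obtain M' where M': "write_once_ntm M'"
    "\<And>w cs. accepting_run M' (write_once_input w) cs \<Longrightarrow> \<exists>n. accepts_in M (ordinary_input w) n"
    "\<And>w m. accepts_in M (ordinary_input w) m \<Longrightarrow> \<exists>cs. accepting_run M' (write_once_input w) cs \<and>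
      run_space cs \<le> 2 * (length w + 2 + (length w + m + 1) * (3 + 2 * ?g * m))"
    using simulate_ordinary[OF M] by blast
  \<comment> \<open>For the sum \<open>z\<close> of the time bound and the input length:
    \<open>n + 2\<close> is at most \<open>2 * z ^ 2\<close>, there are at most \<open>2 * z\<close>
    blocks, and the bound on a block is at most \<open>(3 + 2 * g) * z\<close>. The outer factor 2
    is the splitting of cells.\<close>
  define C where "C = 2 * (2 + 2 * (3 + 2 * ?g))"
  obtain t' where t': "\<And>n. 2 \<le> n \<Longrightarrow> C * (iter_exp k (n ^ t) + n) ^ 2 \<le> iter_exp k (n ^ t')"
    using iter_exp_absorbs_polynomial by meson
  have "\<exists>cs. accepting_run M' (write_once_input w) cs \<and> run_space cs \<le> iter_exp k (length w ^ t')"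
    if w: "w \<in> L" "2 \<le> length w" for w
  proof -
    let ?z = "iter_exp k (length w ^ t) + length w"
    obtain m where m: "accepts_in M (ordinary_input w) m" "m \<le> iter_exp k (length w ^ t)"
      using time[OF w] unfolding accepts_in_iff by blast
    have "length w + 2 \<le> 2 * ?z" using w(2) by simp
    also have "\<dots> \<le> 2 * ?z\<^sup>2" by (intro mult_le_mono2 self_le_power) (use w(2) in auto)
    finally have 1: "length w + 2 \<le> 2 * ?z\<^sup>2" .
    have "3 + 2 * ?g * m \<le> 3 * ?z + 2 * ?g * ?z"
      using m(2) w(2) by (intro add_mono mult_le_mono2) auto
    then have "3 + 2 * ?g * m \<le> (3 + 2 * ?g) * ?z" by (simp only: add_mult_distrib)
    then have "(length w + m + 1) * (3 + 2 * ?g * m) \<le> (2 * ?z) * ((3 + 2 * ?g) * ?z)"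
      using m(2) w(2) by (intro mult_le_mono) auto
    also have "\<dots> = 2 * (3 + 2 * ?g) * ?z\<^sup>2" by (simp only: power2_eq_square ac_simps)
    finally have "2 * (length w + 2 + (length w + m + 1) * (3 + 2 * ?g * m)) \<le>
      2 * (2 * ?z\<^sup>2 + 2 * (3 + 2 * ?g) * ?z\<^sup>2)"
      using 1 by (intro mult_le_mono2 add_mono)
    also have "\<dots> = C * ?z\<^sup>2" by (simp only: C_def add_mult_distrib add_mult_distrib2 ac_simps)
    also have "\<dots> \<le> iter_exp k (length w ^ t')" using t' w(2) by blast
    finally show ?thesis using M'(3)[OF m(1)] by (meson le_trans)
  qed
  moreover have "L = {w. \<exists>cs. accepting_run M' (write_once_input w) cs}"
    using M'(2,3) unfolding L accepting_run_iff[of M] by blast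
  ultimately show "L \<in> k_NEXPWOSPACE k"
    using M'(1) unfolding k_NEXPWOSPACE_def by blast
qed

theorem theorem3:
  fixes k :: nat
  shows "k_NEXPTIME k = k_NEXPWOSPACE k"
  using NEXPTIME_subset_NEXPWOSPACE NEXPWOSPACE_subset_NEXPTIME by (rule equalityI)

end
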